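(* Let $\mathcal A$ be a commutative unital $C^*$-algebra, let $\mathcal H$ be a finitely or countably generated Hilbert $\mathcal A$-module, and let $\mathcal G$ be a unitary group on $\mathcal H$. Suppose that $\Phi=\{\phi_1,\phi_2,\dots,\phi_N\}$ is a multi-frame generator for $\mathcal G$. Let $S$ be the frame operator of the multi-frame $\{U\phi_j: j=1,\dots,N,\ U\in\mathcal G\}$, i.e. $Sx=\sum_{j=1}^{N}\sum_{U\in\mathcal G}\langle x,U\phi_j\rangle U\phi_j$ for $x\in\mathcal H$. Then $S^{-1/2}\Phi=\{S^{-1/2}\phi_1,\dots,S^{-1/2}\phi_N\}$ is the unique best Parseval multi-frame approximation for $\Phi$.
   Context: Hilbert $\mathcal A$-modules are left modules over a $C^*$-algebra $\mathcal A$ with an $\mathcal A$-valued inner product $\langle\cdot,\cdot\rangle$ that is $\mathcal A$-linear in the first variable and satisfies $\langle x,y\rangle=\langle y,x\rangle^*$; they are complete in the norm $\|x\|=\|\langle x,x\rangle\|^{1/2}$. $\mathcal H$ is finitely (resp. countably) generated if it has a finite (algebraic) generating set (resp. a countable set of generators). A unitary group on $\mathcal H$ is a group $\mathcal G$ (under composition) of unitary (adjointable) operators on $\mathcal H$. A family $\{x_j\}_{j\in\mathbb J}$ in $\mathcal H$ ($\mathbb J$ finite or countable) is a (standard) frame for $\mathcal H$ if there are constants $C,D>0$ such that $C\langle x,x\rangle\le\sum_{j}\langle x,x_j\rangle\langle x_j,x\rangle\le D\langle x,x\rangle$ for all $x\in\mathcal H$, where the sum converges in norm; it is a Parseval frame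 if one can take $C=D=1$. An $N$-tuple $\Phi=(\phi_1,\dots,\phi_N)$ of vectors in $\mathcal H$ is a multi-frame generator (resp. Parseval multi-frame generator) for $\mathcal G$ if the family $\{U\phi_j: U\in\mathcal G,\ j=1,\dots,N\}$, indexed by $\mathcal G\times\{1,\dots,N\}$, is a frame (resp. Parseval frame) for $\mathcal H$. Let $\Phi=(\phi_1,\dots,\phi_N)$ be a multi-frame generator for $\mathcal G$. A Parseval multi-frame generator $\Psi=(\psi_1,\dots,\psi_N)$ for $\mathcal G$ is called a best Parseval multi-frame approximation for $\Phi$ if $$\sum_{k=1}^{N}\langle\phi_k-\psi_k,\phi_k-\psi_k\rangle\le\sum_{k=1}^{N}\langle\phi_k-\xi_k,\phi_k-\xi_k\rangle$$ (in the order of $\mathcal A$) for every Parseval multi-frame generator $\Xi=(\xi_1,\dots,\xi_N)$ for $\mathcal G$. *)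

theory Defs
  imports "HOL-Analysis.Analysis"
begin

section \<open>Unital C*-algebras\<close>

text \<open>
  The underlying unital Banach algebra over the reals is the library's; the complex scalar
  multiplication and the involution are added on top. The class \<open>real_normed_algebra_1\<close> entails
  that the algebra is nonzero.
\<close>

class unital_cstar_algebra = real_normed_algebra_1 + banach +
  fixes scaleC :: "complex \<Rightarrow> 'a \<Rightarrow> 'a"  (infixr \<open>*\<^sub>C\<close> 75)
    and star :: "'a \<Rightarrow> 'a"
  assumes scaleR_scaleC: "r *\<^sub>R a = complex_of_real r *\<^sub>C a"
    and scaleC_add_right: "c *\<^sub>C (a + b) = c *\<^sub>C a + c *\<^sub>C b"
    and scaleC_add_left: "(c + d) *\<^sub>C a = c *\<^sub>C a + d *\<^sub>C a"
    and scaleC_scaleC: "c *\<^sub>C (d *\<^sub>C a) = (c * d) *\<^sub>C a"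
    and mult_scaleC_left: "(c *\<^sub>C a) * b = c *\<^sub>C (a * b)"
    and mult_scaleC_right: "a * (c *\<^sub>C b) = c *\<^sub>C (a * b)"
    and norm_scaleC: "norm (c *\<^sub>C a) = cmod c * norm a"
    and star_add: "star (a + b) = star a + star b"
    and star_scaleC: "star (c *\<^sub>C a) = cnj c *\<^sub>C star a"
    and star_mult: "star (a * b) = star b * star a"
    and star_star: "star (star a) = a"
    and cstar_identity: "norm (star a * a) = (norm a)\<^sup>2"

definition spectrum :: "'a::unital_cstar_algebra \<Rightarrow> complex set" where
  "spectrum a = {c. \<not> (\<exists>b. (a - c *\<^sub>C 1) * b = 1 \<and> b * (a - c *\<^sub>C 1) = 1)}"

definition cstar_positive :: "'a::unital_cstar_algebra \<Rightarrow> bool" where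
  "cstar_positive a \<longleftrightarrow> star a = a \<and> spectrum a \<subseteq> \<real>\<^sub>\<ge>\<^sub>0"

definition cstar_le :: "'a::unital_cstar_algebra \<Rightarrow> 'a \<Rightarrow> bool"  (infix \<open>\<le>\<^sub>A\<close> 50) where
  "a \<le>\<^sub>A b \<longleftrightarrow> cstar_positive (b - a)"


section \<open>Hilbert modules over commutative unital C*-algebras\<close>

text \<open>
  The norm of the type \<open>'h\<close> is tied to the inner product by \<open>norm_eq\<close>, so completeness of the module
  is the class constraint \<open>banach\<close>, and the library's closures and infinite sums in \<open>'h\<close> refer to
  the module norm. The complex scalar \<open>c\<close> acts on the module as the algebra element \<open>c *\<^sub>C 1\<close>, so
  that linearity over the algebra includes complex linearity; \<open>scaleR_eq\<close> says that the real
  scalars of the class do the same.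
\<close>

locale hilbert_module = module smul
  for smul :: "'a::{unital_cstar_algebra, comm_ring_1} \<Rightarrow> 'h::banach \<Rightarrow> 'h" +
  fixes ip :: "'h \<Rightarrow> 'h \<Rightarrow> 'a"
  assumes scaleR_eq: "r *\<^sub>R x = smul (r *\<^sub>R 1) x"
    and ip_add_left: "ip (x + y) z = ip x z + ip y z"
    and ip_smul_left: "ip (smul a x) y = a * ip x y"
    and ip_star: "ip x y = star (ip y x)"
    and ip_positive: "cstar_positive (ip x x)"
    and ip_definite: "ip x x = 0 \<Longrightarrow> x = 0"
    and norm_eq: "norm x = sqrt (norm (ip x x))"

definition finitely_generated ::
    "('a::comm_ring_1 \<Rightarrow> 'h::ab_group_add \<Rightarrow> 'h) \<Rightarrow> bool" where
  "finitely_generated smul \<longleftrightarrow> (\<exists>B. finite B \<and> module.span smul B = UNIV)"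

text \<open>
  As usual for Hilbert modules, countable generation is topological, whereas finite generation is
  algebraic.
\<close>

definition countably_generated ::
    "('a::comm_ring_1 \<Rightarrow> 'h::real_normed_vector \<Rightarrow> 'h) \<Rightarrow> bool" where
  "countably_generated smul \<longleftrightarrow> (\<exists>B. countable B \<and> closure (module.span smul B) = UNIV)"


section \<open>Operators\<close>

text \<open>Below, \<open>ip\<close> is the inner product of the module. Adjointable maps are automatically bounded
  and linear over the algebra.\<close>

definition is_adjoint :: "('h \<Rightarrow> 'h \<Rightarrow> 'a) \<Rightarrow> ('h \<Rightarrow> 'h) \<Rightarrow> ('h \<Rightarrow> 'h) \<Rightarrow> bool" where
  "is_adjoint ip T T' \<longleftrightarrow> (\<forall>x y. ip (T x) y = ip x (T' y))"

definition unitary_op :: "('h \<Rightarrow> 'h \<Rightarrow> 'a) \<Rightarrow> ('h \<Rightarrow> 'h) \<Rightarrow> bool" where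
  "unitary_op ip U \<longleftrightarrow> (\<exists>U'. is_adjoint ip U U' \<and> U' \<circ> U = id \<and> U \<circ> U' = id)"

definition unitary_group :: "('h \<Rightarrow> 'h \<Rightarrow> 'a) \<Rightarrow> ('h \<Rightarrow> 'h) set \<Rightarrow> bool" where
  "unitary_group ip G \<longleftrightarrow>
     (\<forall>U\<in>G. unitary_op ip U) \<and> id \<in> G \<and> (\<forall>U\<in>G. \<forall>V\<in>G. U \<circ> V \<in> G) \<and> (\<forall>U\<in>G. inv U \<in> G)"

definition positive_op ::
    "('h \<Rightarrow> 'h \<Rightarrow> 'a::unital_cstar_algebra) \<Rightarrow> ('h \<Rightarrow> 'h) \<Rightarrow> bool" where
  "positive_op ip T \<longleftrightarrow> is_adjoint ip T T \<and> (\<forall>x. cstar_positive (ip (T x) x))"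

text \<open>The positive square root of a positive adjointable operator exists and is unique; the
  definite description is only meaningful for such operators.\<close>

definition op_sqrt ::
    "('h \<Rightarrow> 'h \<Rightarrow> 'a::unital_cstar_algebra) \<Rightarrow> ('h \<Rightarrow> 'h) \<Rightarrow> ('h \<Rightarrow> 'h)" where
  "op_sqrt ip P = (THE R. positive_op ip R \<and> R \<circ> R = P)"

definition op_inv_sqrt ::
    "('h \<Rightarrow> 'h \<Rightarrow> 'a::unital_cstar_algebra) \<Rightarrow> ('h \<Rightarrow> 'h) \<Rightarrow> ('h \<Rightarrow> 'h)" where
  "op_inv_sqrt ip S = op_sqrt ip (inv S)"


section \<open>Frames and multi-frame generators\<close>

text \<open>The sums over the index set are unordered norm-convergent sums. Since their terms are positive,
  this is the same as norm convergence along some enumeration of the index set.\<close>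

definition frame_bounds ::
    "('h \<Rightarrow> 'h \<Rightarrow> 'a::unital_cstar_algebra) \<Rightarrow> 'i set \<Rightarrow> ('i \<Rightarrow> 'h) \<Rightarrow> real \<Rightarrow> real \<Rightarrow> bool" where
  "frame_bounds ip J f C D \<longleftrightarrow> countable J \<and>
     (\<forall>x. (\<lambda>j. ip x (f j) * ip (f j) x) summable_on J \<and>
          C *\<^sub>R ip x x \<le>\<^sub>A (\<Sum>\<^sub>\<infinity>j\<in>J. ip x (f j) * ip (f j) x) \<and>
          (\<Sum>\<^sub>\<infinity>j\<in>J. ip x (f j) * ip (f j) x) \<le>\<^sub>A D *\<^sub>R ip x x)"

definition is_frame ::
    "('h \<Rightarrow> 'h \<Rightarrow> 'a::unital_cstar_algebra) \<Rightarrow> 'i set \<Rightarrow> ('i \<Rightarrow> 'h) \<Rightarrow> bool" where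
  "is_frame ip J f \<longleftrightarrow> (\<exists>C>0. \<exists>D>0. frame_bounds ip J f C D)"

definition is_parseval_frame ::
    "('h \<Rightarrow> 'h \<Rightarrow> 'a::unital_cstar_algebra) \<Rightarrow> 'i set \<Rightarrow> ('i \<Rightarrow> 'h) \<Rightarrow> bool" where
  "is_parseval_frame ip J f \<longleftrightarrow> frame_bounds ip J f 1 1"

text \<open>An \<open>N\<close>-tuple of vectors is a function on the naturals of which only the values at
  \<open>1, \<dots>, N\<close> matter.\<close>

definition multi_frame_generator ::
    "('h \<Rightarrow> 'h \<Rightarrow> 'a::unital_cstar_algebra) \<Rightarrow> ('h \<Rightarrow> 'h) set \<Rightarrow> nat \<Rightarrow> (nat \<Rightarrow> 'h) \<Rightarrow> bool" where
  "multi_frame_generator ip G N \<phi> \<longleftrightarrow> is_frame ip (G \<times> {1..N}) (\<lambda>(U, j). U (\<phi> j))"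

definition parseval_multi_frame_generator ::
    "('h \<Rightarrow> 'h \<Rightarrow> 'a::unital_cstar_algebra) \<Rightarrow> ('h \<Rightarrow> 'h) set \<Rightarrow> nat \<Rightarrow> (nat \<Rightarrow> 'h) \<Rightarrow> bool" where
  "parseval_multi_frame_generator ip G N \<psi> \<longleftrightarrow>
     is_parseval_frame ip (G \<times> {1..N}) (\<lambda>(U, j). U (\<psi> j))"

definition frame_operator ::
    "('a \<Rightarrow> 'h::real_normed_vector \<Rightarrow> 'h) \<Rightarrow> ('h \<Rightarrow> 'h \<Rightarrow> 'a) \<Rightarrow> ('h \<Rightarrow> 'h) set \<Rightarrow> nat \<Rightarrow>
     (nat \<Rightarrow> 'h) \<Rightarrow> 'h \<Rightarrow> 'h" where
  "frame_operator smul ip G N \<phi> x =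
     (\<Sum>j=1..N. \<Sum>\<^sub>\<infinity>U\<in>G. smul (ip x (U (\<phi> j))) (U (\<phi> j)))"

definition best_parseval_approximation ::
    "('h::ab_group_add \<Rightarrow> 'h \<Rightarrow> 'a::unital_cstar_algebra) \<Rightarrow> ('h \<Rightarrow> 'h) set \<Rightarrow> nat \<Rightarrow>
     (nat \<Rightarrow> 'h) \<Rightarrow> (nat \<Rightarrow> 'h) \<Rightarrow> bool" where
  "best_parseval_approximation ip G N \<phi> \<psi> \<longleftrightarrow>
     parseval_multi_frame_generator ip G N \<psi> \<and>
     (\<forall>\<xi>. parseval_multi_frame_generator ip G N \<xi> \<longrightarrow>
        (\<Sum>k=1..N. ip (\<phi> k - \<psi> k) (\<phi> k - \<psi> k)) \<le>\<^sub>A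
        (\<Sum>k=1..N. ip (\<phi> k - \<xi> k) (\<phi> k - \<xi> k)))"

end

theory Submission
  imports Defs
begin

text \<open>
  Let \<open>B = sqrt S\<close> and \<open>\<psi> k = (sqrt S)\<inverse> (\<phi> k)\<close>, so \<open>\<phi> k = B (\<psi> k)\<close>; both roots commute with \<open>G\<close>. Since the algebra is
  commutative, expanding one Parseval system in the other shows that \<open>\<Sum>k. \<langle>A (\<xi> k), \<xi> k\<rangle>\<close> takes the same
  value at all Parseval multi-frame generators \<open>\<xi>\<close>, for every self-adjoint \<open>A\<close> commuting with \<open>G\<close>. With
  \<open>A = id\<close> and \<open>A = B\<close> this gives
  \<open>\<Sum>k. \<langle>\<phi> k - \<xi> k, \<phi> k - \<xi> k\<rangle> - \<Sum>k. \<langle>\<phi> k - \<psi> k, \<phi> k - \<psi> k\<rangle> = \<Sum>k. \<langle>B (\<psi> k - \<xi> k), \<psi> k - \<xi> k\<rangle>\<close>,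
  which is positive and vanishes only for \<open>\<xi> = \<psi>\<close>.
\<close>

section \<open>Positivity in commutative unital C*-algebras\<close>

text \<open>Positivity is a condition on the spectrum, from which stability under sums and limits
  cannot be read off. Both come from the criterion \<open>norm (s *\<^sub>R 1 - a) \<le> s\<close>,
  and passing from the spectrum back to the norm requires that the norm of a self-adjoint element is
  attained by its spectrum. The square root of \<open>S\<close> must commute with every bounded
  operator that commutes with \<open>S\<close>: applied to the unitaries, this makes the candidate a
  Parseval generator; applied to a second positive root of the inverse of \<open>S\<close>, it gives
  the uniqueness that evaluates the definite description in \<open>op_sqrt\<close>. A contraction on
  a closed set of operators with this property produces such a root. The order of the algebra is
  only partial, so a least distance need not exist for general reasons. The exact cancellation of
  the trace terms is what makes every competitor comparable with the candidate.\<close>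

lemma scaleC_1 [simp]: "1 *\<^sub>C (a :: 'a::unital_cstar_algebra) = a"
  using scaleR_scaleC[of 1 a] by simp

lemma scaleC_0_left [simp]: "0 *\<^sub>C (a :: 'a::unital_cstar_algebra) = 0"
  using scaleR_scaleC[of 0 a] by simp

lemma scaleC_0_right [simp]: "c *\<^sub>C (0 :: 'a::unital_cstar_algebra) = 0"
  using scaleC_add_right[of c 0 "0::'a"] by simp

lemma scaleC_minus_left: "(- c) *\<^sub>C (a :: 'a::unital_cstar_algebra) = - (c *\<^sub>C a)"
  using scaleC_add_left[of "-c" c a] by (simp add: eq_neg_iff_add_eq_0)

lemma scaleC_minus_right: "c *\<^sub>C (- a :: 'a::unital_cstar_algebra) = - (c *\<^sub>C a)"
  using scaleC_add_right[of c "-a" a] by (simp add: eq_neg_iff_add_eq_0)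

lemma scaleC_diff_left: "(c - d) *\<^sub>C (a :: 'a::unital_cstar_algebra) = c *\<^sub>C a - d *\<^sub>C a"
  using scaleC_add_left[of c "-d" a] by (simp add: scaleC_minus_left)

lemma scaleC_diff_right: "c *\<^sub>C (a - b :: 'a::unital_cstar_algebra) = c *\<^sub>C a - c *\<^sub>C b"
  using scaleC_add_right[of c a "-b"] by (simp add: scaleC_minus_right)

lemma star_0 [simp]: "star (0 :: 'a::unital_cstar_algebra) = 0"
  using star_add[of 0 "0::'a"] by simp

lemma star_1 [simp]: "star (1 :: 'a::unital_cstar_algebra) = 1"
  by (metis mult.right_neutral mult_1 star_mult star_star)

lemma star_minus [simp]: "star (- a :: 'a::unital_cstar_algebra) = - star a"
  using star_add[of a "-a"] by (simp add: eq_neg_iff_add_eq_0 add.commute)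

lemma star_diff [simp]: "star (a - b :: 'a::unital_cstar_algebra) = star a - star b"
  using star_add[of a "-b"] by simp

lemma star_scaleR [simp]: "star (r *\<^sub>R a :: 'a::unital_cstar_algebra) = r *\<^sub>R star a"
  by (simp add: scaleR_scaleC star_scaleC)

lemma star_power [simp]: "star (a ^ n :: 'a::unital_cstar_algebra) = star a ^ n"
  by (induction n) (simp_all add: star_mult power_commutes)

lemma star_sum: "star (sum f F) = (\<Sum>i\<in>F. star (f i :: 'a::unital_cstar_algebra))"
  by (induction F rule: infinite_finite_induct) (simp_all add: star_add)

lemma norm_star [simp]: "norm (star a) = norm (a :: 'a::unital_cstar_algebra)"
proof -
  have le: "norm b \<le> norm (star b)" for b :: 'a
  proof (cases "b = 0")
    case False
    have "norm b * norm b \<le> norm (star b) * norm b"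
      using cstar_identity[of b] norm_mult_ineq[of "star b" b] by (simp add: power2_eq_square)
    then show ?thesis using False by simp
  qed simp
  show ?thesis using le[of a] le[of "star a"] by (simp add: star_star)
qed

lemma bounded_linear_star: "bounded_linear (star :: 'a::unital_cstar_algebra \<Rightarrow> 'a)"
  by (rule bounded_linear_intro[where K = 1]) (simp_all add: star_add)

text \<open>The C*-identity turns squaring a self-adjoint element into squaring its norm, so the
  induction reaches exactly the exponents \<open>2 ^ m\<close>, which are the ones met when
  exponents are doubled.\<close>

lemma norm_power_self_adjoint:
  fixes a :: "'a::unital_cstar_algebra"
  assumes "star a = a"
  shows "norm (a ^ 2 ^ m) = norm a ^ 2 ^ m"
proof (induction m)
  case (Suc m)
  have "norm (a ^ 2 ^ Suc m) = norm (star (a ^ 2 ^ m) * a ^ 2 ^ m)"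
    using assms by (simp add: power_add mult_2)
  also have "\<dots> = norm a ^ 2 ^ Suc m"
    unfolding cstar_identity Suc by (simp add: power_even_eq)
  finally show ?case .
qed simp

text \<open>In a commutative ring invertibility is divisibility of \<open>1\<close>, so
  factorisations of \<open>a - c *\<^sub>C 1\<close> can be exploited through
  \<open>mult_dvd_one\<close>.\<close>

lemma spectrum_iff_not_dvd:
  "c \<in> spectrum a \<longleftrightarrow> \<not> (a - c *\<^sub>C 1) dvd (1 :: 'a::{unital_cstar_algebra, comm_ring_1})"
  unfolding spectrum_def by (auto simp: dvd_def mult.commute)

text \<open>The Neumann series: the powers of \<open>a\<close> are summable by completeness, and
  their sum telescopes against \<open>1 - a\<close>.\<close>

lemma one_minus_dvd_one:
  fixes a :: "'a::{unital_cstar_algebra, comm_ring_1}"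
  assumes "norm a < 1"
  shows "(1 - a) dvd 1"
proof
  have summable: "summable (\<lambda>n. a ^ n)"
    by (rule complete_algebra_summable_geometric[OF assms])
  have "(1 - a) * (\<Sum>n. a ^ n) = (\<Sum>n. a ^ n) - a * (\<Sum>n. a ^ n)"
    by (simp add: algebra_simps)
  also have "a * (\<Sum>n. a ^ n) = (\<Sum>n. a ^ Suc n)"
    using suminf_mult[OF summable, of a] by simp
  also have "\<dots> = (\<Sum>n. a ^ n) - 1"
    using suminf_split_head[OF summable] by simp
  finally show "1 = (1 - a) * (\<Sum>n. a ^ n)" by simp
qed

lemma scaleC_1_dvd_one:
  fixes c :: complex
  assumes "c \<noteq> 0"
  shows "(c *\<^sub>C 1) dvd (1 :: 'a::{unital_cstar_algebra, comm_ring_1})"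
  by (rule dvdI[where k = "inverse c *\<^sub>C 1"])
     (use assms in \<open>simp add: mult_scaleC_left scaleC_scaleC\<close>)

lemma mult_dvd_one:
  fixes a b :: "'a::comm_ring_1"
  assumes "a dvd 1" "b dvd 1"
  shows "a * b dvd 1"
  using mult_dvd_mono[OF assms] by simp

text \<open>If \<open>norm a < cmod c\<close>, then \<open>a - c\<close> is the product of the
  nonzero scalar \<open>- c\<close> and \<open>1 - a / c\<close>, which a Neumann series
  inverts.\<close>

lemma spectrum_norm_le:
  fixes a :: "'a::{unital_cstar_algebra, comm_ring_1}"
  assumes "c \<in> spectrum a"
  shows "cmod c \<le> norm a"
proof (rule ccontr)
  assume "\<not> cmod c \<le> norm a"
  then have gt: "norm a < cmod c" and "c \<noteq> 0" by auto
  have "norm (inverse c *\<^sub>C a) = norm a / cmod c"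
    by (simp add: norm_scaleC norm_inverse divide_inverse)
  also have "\<dots> < 1" using gt \<open>c \<noteq> 0\<close> by simp
  finally have "(1 - inverse c *\<^sub>C a) dvd 1" by (rule one_minus_dvd_one)
  moreover have "((- c) *\<^sub>C 1) dvd (1 :: 'a)" by (rule scaleC_1_dvd_one) (use \<open>c \<noteq> 0\<close> in simp)
  ultimately have "((- c) *\<^sub>C 1) * (1 - inverse c *\<^sub>C a) dvd 1" by (rule mult_dvd_one[rotated])
  also have "((- c) *\<^sub>C 1) * (1 - inverse c *\<^sub>C a) = a - c *\<^sub>C 1"
    using \<open>c \<noteq> 0\<close>
    by (simp add: mult_scaleC_left scaleC_diff_right scaleC_scaleC scaleC_minus_left)
  finally show False using assms by (simp add: spectrum_iff_not_dvd)
qed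

lemma spectrum_shift:
  "c + d \<in> spectrum (a + d *\<^sub>C 1) \<longleftrightarrow> c \<in> spectrum (a :: 'a::unital_cstar_algebra)"
  by (simp add: spectrum_def scaleC_add_left)

lemma spectrum_uminus:
  "- c \<in> spectrum (- a) \<longleftrightarrow> c \<in> spectrum (a :: 'a::{unital_cstar_algebra, comm_ring_1})"
proof -
  have "- a - (- c) *\<^sub>C 1 = - (a - c *\<^sub>C 1)" by (simp add: scaleC_minus_left)
  then show ?thesis unfolding spectrum_iff_not_dvd by (simp only: minus_dvd_iff)
qed

lemma spectrum_scaleR_diff:
  "of_real r - c \<in> spectrum (r *\<^sub>R 1 - a) \<longleftrightarrow>
    c \<in> spectrum (a :: 'a::{unital_cstar_algebra, comm_ring_1})"
  using spectrum_shift[of "-c" "of_real r" "-a"] spectrum_uminus[of c a]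
  by (simp add: scaleR_scaleC)

text \<open>Shifting by a large imaginary multiple of the unit separates the spectrum from the points
  off the real axis, because \<open>norm (a + \<i> t) ^ 2 \<le> norm a ^ 2 + t ^ 2\<close>.\<close>

lemma spectrum_self_adjoint_real:
  fixes a :: "'a::{unital_cstar_algebra, comm_ring_1}"
  assumes "star a = a" and "c \<in> spectrum a"
  shows "c \<in> \<real>"
proof -
  have bound: "(Re c)\<^sup>2 + (Im c + t)\<^sup>2 \<le> (norm a)\<^sup>2 + t\<^sup>2" for t :: real
  proof -
    let ?d = "\<i> * of_real t"
    have "cmod (c + ?d) \<le> norm (a + ?d *\<^sub>C 1)"
      using assms(2) by (intro spectrum_norm_le) (simp add: spectrum_shift)
    then have "(cmod (c + ?d))\<^sup>2 \<le> (norm (a + ?d *\<^sub>C 1))\<^sup>2" by (simp add: power_mono)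
    also have "\<dots> = norm (star (a + ?d *\<^sub>C 1) * (a + ?d *\<^sub>C 1))" by (simp add: cstar_identity)
    also have "star (a + ?d *\<^sub>C 1) * (a + ?d *\<^sub>C 1) = star a * a + (t\<^sup>2) *\<^sub>R 1"
      by (simp add: assms(1) star_add star_scaleC scaleC_minus_left algebra_simps mult_scaleC_left
          mult_scaleC_right scaleC_scaleC scaleR_scaleC power2_eq_square flip: scaleC_add_left)
    also have "norm \<dots> \<le> (norm a)\<^sup>2 + t\<^sup>2"
      using norm_triangle_ineq[of "star a * a" "t\<^sup>2 *\<^sub>R 1"] by (simp add: cstar_identity)
    finally show ?thesis by (simp add: cmod_power2)
  qed
  have "Im c = 0"
  proof (rule ccontr)
    assume "Im c \<noteq> 0"
    \<comment> \<open>This shift makes the cross term \<open>2 * Im c * t\<close> equal to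
      \<open>(norm a)\<^sup>2 + 1\<close>, more than \<open>bound\<close> allows.\<close>
    then show False
      using bound[of "((norm a)\<^sup>2 + 1) / (2 * Im c)"]
      by (simp add: power2_sum) (smt (verit) zero_le_power2)
  qed
  then show ?thesis by (simp add: complex_is_Real_iff)
qed

text \<open>Rickart's elementary proof that the spectral radius of a self-adjoint element is its norm: if
  all \<open>1 - z h\<close> with \<open>\<bar>z\<bar> \<le> 1\<close> are invertible, averaging over roots of unity transports the modulus
  of continuity of \<open>(1 - z h)\<inverse>\<close> to \<open>(1 - (z h) ^ (2 ^ m))\<inverse>\<close>, uniformly in \<open>m\<close>.\<close>

lemma spectral_radius_self_adjoint:
  fixes h :: "'a::{unital_cstar_algebra, comm_ring_1}"
  assumes sa: "star h = h" and norm: "norm h = 1"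
  shows "\<exists>c\<in>spectrum h. 1 \<le> cmod c"
proof (rule ccontr)
  assume "\<not> ?thesis"
  then have small: "cmod c < 1" if "c \<in> spectrum h" for c using that by force
  have "\<exists>b. (1 - z *\<^sub>C h) * b = 1" if "cmod z \<le> 1" for z
  proof (cases "z = 0")
    case False
    have "1 \<le> cmod (inverse z)" using that False by (simp add: norm_inverse one_le_inverse)
    then have "inverse z \<notin> spectrum h" using small[of "inverse z"] by fastforce
    then have "(h - inverse z *\<^sub>C 1) dvd 1" by (simp add: spectrum_iff_not_dvd)
    moreover have "((- z) *\<^sub>C 1) dvd (1 :: 'a)" by (rule scaleC_1_dvd_one) (use False in simp)
    ultimately have "((- z) *\<^sub>C 1) * (h - inverse z *\<^sub>C 1) dvd 1" by (rule mult_dvd_one[rotated])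
    also have "((- z) *\<^sub>C 1) * (h - inverse z *\<^sub>C 1) = 1 - z *\<^sub>C h"
      using False
      by (simp add: mult_scaleC_left scaleC_diff_right scaleC_scaleC scaleC_minus_left)
    finally show ?thesis by (metis dvdE)
  qed simp
  then obtain R where R: "\<And>z. cmod z \<le> 1 \<Longrightarrow> (1 - z *\<^sub>C h) * R z = 1" by metis
  \<comment> \<open>A resolvent identity. It controls the variation of \<open>R\<close> only in
    terms of \<open>norm (R w)\<close>, which therefore has to be bounded near \<open>z\<close>
    first.\<close>
  have R_diff: "R w - R z = (w - z) *\<^sub>C (R w * R z * h)" if "cmod w \<le> 1" "cmod z \<le> 1" for w z
  proof -
    have "R w - R z = R w * ((1 - z *\<^sub>C h) * R z) - R z * ((1 - w *\<^sub>C h) * R w)"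
      by (simp add: R that)
    also have "\<dots> = R w * R z * ((w - z) *\<^sub>C h)"
      by (simp add: scaleC_diff_left algebra_simps)
    finally show ?thesis by (simp add: mult_scaleC_right)
  qed
  have cont: "continuous_on (cball 0 1) R"
    unfolding continuous_on_iff
  proof (intro ballI allI impI)
    fix z and e :: real assume z: "z \<in> cball (0::complex) 1" and e: "0 < e"
    define M where "M = norm (R z) + 1"
    have M: "M > 0" "norm (R z) \<le> M" by (auto simp: M_def add_nonneg_pos)
    show "\<exists>d>0. \<forall>w\<in>cball 0 1. dist w z < d \<longrightarrow> dist (R w) (R z) < e"
    proof (intro exI conjI ballI impI)
      \<comment> \<open>The first radius lets half of \<open>norm (R w)\<close> be absorbed, giving
        \<open>norm (R w) \<le> 2 * M\<close>; with this the second makes the variation smaller than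
        \<open>e / 2\<close>.\<close>
      show "0 < min (1 / (2 * M)) (e / (4 * M\<^sup>2))" using M e by simp
      fix w assume w: "w \<in> cball (0::complex) 1"
        and wz: "dist w z < min (1 / (2 * M)) (e / (4 * M\<^sup>2))"
      have "norm (R w * R z * h) \<le> norm (R w) * norm (R z) * norm h"
        by (rule order_trans[OF norm_mult_ineq mult_right_mono[OF norm_mult_ineq]]) simp
      also have "\<dots> \<le> norm (R w) * M" using M norm by (simp add: mult_left_mono)
      finally have "norm (R w - R z) \<le> dist w z * (norm (R w) * M)"
        using w z by (simp add: R_diff norm_scaleC dist_norm mult_left_mono)
      then have *: "norm (R w - R z) \<le> (dist w z * M) * norm (R w)" by (simp add: mult_ac)
      have "dist w z * M < 1/2" using wz M by (simp add: field_simps)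
      then have "(dist w z * M) * norm (R w) \<le> 1/2 * norm (R w)" by (intro mult_right_mono) auto
      then have "norm (R w) \<le> 2 * M" using * M norm_triangle_sub[of "R w" "R z"] by linarith
      then have "(dist w z * M) * norm (R w) \<le> (dist w z * M) * (2 * M)"
        using M by (intro mult_left_mono) auto
      also have "\<dots> = dist w z * (2 * M\<^sup>2)" by (simp add: power2_eq_square)
      also have "\<dots> < (e / (4 * M\<^sup>2)) * (2 * M\<^sup>2)" using wz M by (intro mult_strict_right_mono) auto
      also have "\<dots> \<le> e" using M e by (simp add: field_simps)
      finally show "dist (R w) (R z) < e" using * by (simp add: dist_norm)
    qed
  qed
  then have "uniformly_continuous_on (cball 0 1) R"
    by (intro compact_uniformly_continuous) auto
  then obtain d where d: "d > 0"
    and unif: "\<And>w z. \<lbrakk>cmod w \<le> 1; cmod z \<le> 1; dist w z < d\<rbrakk> \<Longrightarrow> dist (R w) (R z) < 1/8"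
    unfolding uniformly_continuous_on_def
    by (metis (no_types, opaque_lifting) mem_cball dist_0_norm zero_less_divide_1_iff zero_less_numeral)
  define r where "r = max (1 - d / 2) (1/2)"
  have r: "0 < r" "r < 1" "1 - r < d" using d by (auto simp: r_def)
  have step: "\<exists>G. \<forall>z. cmod z \<le> 1 \<longrightarrow> (1 - z ^ 2 ^ m *\<^sub>C h ^ 2 ^ m) * G z = 1 \<and>
      norm (G (of_real r * z) - G z) \<le> 1/8" for m
  proof (induction m)
    case 0
    have "norm (R (of_real r * z) - R z) \<le> 1/8" if "cmod z \<le> 1" for z
    proof -
      have "of_real r * z - z = of_real (r - 1) * z" by (simp add: algebra_simps)
      then have "dist (of_real r * z) z = (1 - r) * cmod z"
        unfolding dist_norm using r by (simp only: norm_mult norm_of_real) simp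
      also have "\<dots> \<le> (1 - r) * 1" using that r by (intro mult_left_mono) auto
      finally have "dist (of_real r * z) z < d" using r by simp
      moreover have "cmod (of_real r * z) \<le> 1" using that r by (simp add: norm_mult mult_le_one)
      ultimately show ?thesis using unif[of "of_real r * z" z] that by (simp add: dist_norm)
    qed
    then show ?case using R by (intro exI[of _ R]) simp
  next
    case (Suc m)
    then obtain G where G: "\<And>z. cmod z \<le> 1 \<Longrightarrow> (1 - z ^ 2 ^ m *\<^sub>C h ^ 2 ^ m) * G z = 1"
      and G_diff: "\<And>z. cmod z \<le> 1 \<Longrightarrow> norm (G (of_real r * z) - G z) \<le> 1/8"
      by blast
    \<comment> \<open>As \<open>\<zeta> ^ 2 ^ m = -1\<close>, the values of \<open>G\<close> at
      \<open>z\<close> and \<open>\<zeta> * z\<close> invert \<open>1 - q\<close> and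
      \<open>1 + q\<close>, and half their sum inverts \<open>1 - q * q\<close>. Averaging preserves
      the bound \<open>1/8\<close>.\<close>
    define \<zeta> where "\<zeta> = cis (pi / 2 ^ m)"
    have "\<zeta> ^ 2 ^ m = cis (real (2 ^ m) * (pi / 2 ^ m))" unfolding \<zeta>_def by (rule Complex.DeMoivre)
    then have \<zeta>: "\<zeta> ^ 2 ^ m = -1" "cmod \<zeta> = 1" by (simp_all add: \<zeta>_def)
    have "(1 - z ^ 2 ^ Suc m *\<^sub>C h ^ 2 ^ Suc m) * ((1/2) *\<^sub>R (G z + G (\<zeta> * z))) = 1 \<and>
      norm ((1/2) *\<^sub>R (G (of_real r * z) + G (\<zeta> * (of_real r * z))) -
        (1/2) *\<^sub>R (G z + G (\<zeta> * z))) \<le> 1/8" if z: "cmod z \<le> 1" for z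
    proof
      define q where "q = z ^ 2 ^ m *\<^sub>C h ^ 2 ^ m"
      have \<zeta>z: "cmod (\<zeta> * z) \<le> 1" using z \<zeta> by (simp add: norm_mult)
      have 1: "(1 - q) * G z = 1" using G[OF z] by (simp add: q_def)
      have 2: "(1 + q) * G (\<zeta> * z) = 1"
        using G[OF \<zeta>z] by (simp add: q_def power_mult_distrib \<zeta> scaleC_minus_left)
      have "z ^ 2 ^ Suc m *\<^sub>C h ^ 2 ^ Suc m = q * q"
        by (simp add: q_def mult_scaleC_left mult_scaleC_right scaleC_scaleC mult_2 power_add)
      moreover have "(1 - q * q) * (G z + G (\<zeta> * z)) =
          (1 + q) * ((1 - q) * G z) + (1 - q) * ((1 + q) * G (\<zeta> * z))"
        by (simp add: algebra_simps)
      moreover have "\<dots> = 2 *\<^sub>R 1" by (simp add: 1 2 scaleR_2)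
      ultimately show "(1 - z ^ 2 ^ Suc m *\<^sub>C h ^ 2 ^ Suc m) * ((1/2) *\<^sub>R (G z + G (\<zeta> * z))) = 1"
        by simp
      have "norm (G (of_real r * z) - G z + (G (of_real r * (\<zeta> * z)) - G (\<zeta> * z))) \<le> 1/8 + 1/8"
        by (intro norm_triangle_mono G_diff z \<zeta>z)
      moreover have "(1/2) *\<^sub>R (G (of_real r * z) + G (\<zeta> * (of_real r * z))) -
          (1/2) *\<^sub>R (G z + G (\<zeta> * z)) =
          (1/2) *\<^sub>R (G (of_real r * z) - G z + (G (of_real r * (\<zeta> * z)) - G (\<zeta> * z)))"
        by (simp add: algebra_simps)
      ultimately show "norm ((1/2) *\<^sub>R (G (of_real r * z) + G (\<zeta> * (of_real r * z))) -
        (1/2) *\<^sub>R (G z + G (\<zeta> * z))) \<le> 1/8" by simp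
    qed
    then show ?case by (intro exI[of _ "\<lambda>z. (1/2) *\<^sub>R (G z + G (\<zeta> * z))"]) blast
  qed
  \<comment> \<open>With \<open>norm p \<le> 1/9\<close> the inverse \<open>G r\<close> is within
    \<open>1/8\<close> of \<open>1\<close>, hence \<open>G 1\<close> is within \<open>1/4\<close>.
    But \<open>G 1\<close> inverts \<open>1 - q\<close> with \<open>norm q = 1\<close>, and solving
    for \<open>q\<close> gives \<open>norm q \<le> 1/4 + 1/4\<close>.\<close>
  obtain k where k: "r ^ k < 1/9" using real_arch_pow_inv[of "1/9" r] r by auto
  define q where "q = h ^ 2 ^ k"
  have q: "norm q = 1" by (simp add: q_def norm_power_self_adjoint sa norm)
  obtain G where G: "\<And>z. cmod z \<le> 1 \<Longrightarrow> (1 - z ^ 2 ^ k *\<^sub>C q) * G z = 1"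
    and G_diff: "\<And>z. cmod z \<le> 1 \<Longrightarrow> norm (G (of_real r * z) - G z) \<le> 1/8"
    using step[of k] unfolding q_def by blast
  define p where "p = of_real r ^ 2 ^ k *\<^sub>C q"
  have "norm p = r ^ 2 ^ k" using r by (simp add: p_def norm_scaleC q norm_power)
  also have "\<dots> \<le> r ^ k" using r by (intro power_decreasing) auto
  finally have p: "norm p \<le> 1/9" using k by simp
  have "(1 - p) * G r = 1" using G[of r] r by (simp add: p_def)
  then have "G r - 1 = p * (G r - 1) + p" by (simp add: algebra_simps)
  then have "norm (G r - 1) \<le> norm (p * (G r - 1)) + norm p" by (metis norm_triangle_ineq)
  also have "\<dots> \<le> norm p * norm (G r - 1) + norm p" by (simp add: norm_mult_ineq)
  also have "\<dots> \<le> 1/9 * norm (G r - 1) + 1/9" using p by (intro add_mono mult_right_mono) auto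
  finally have "norm (G r - 1) \<le> 1/8" by simp
  moreover have "norm (G r - G 1) \<le> 1/8" using G_diff[of 1] by simp
  ultimately have G1: "norm (G 1 - 1) \<le> 1/4"
    using norm_triangle_ineq4[of "G r - 1" "G r - G 1"] by simp
  have "(1 - q) * G 1 = 1" using G[of 1] by simp
  then have "q = G 1 - 1 - q * (G 1 - 1)" by (simp add: algebra_simps)
  then have "norm q \<le> norm (G 1 - 1) + norm (q * (G 1 - 1))" by (metis norm_triangle_ineq4)
  also have "\<dots> \<le> norm (G 1 - 1) + norm q * norm (G 1 - 1)" by (simp add: norm_mult_ineq)
  finally show False using q G1 by simp
qed

text \<open>Normalise \<open>a\<close> to norm \<open>1\<close>; a spectral value of modulus at
  least \<open>1\<close> scales back to one of modulus at least \<open>norm a\<close>.\<close>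

lemma norm_le_of_spectrum:
  fixes a :: "'a::{unital_cstar_algebra, comm_ring_1}"
  assumes sa: "star a = a" and le: "\<And>c. c \<in> spectrum a \<Longrightarrow> cmod c \<le> r" and "0 \<le> r"
  shows "norm a \<le> r"
proof (cases "a = 0")
  case False
  let ?s = "inverse (norm a)"
  have "norm (?s *\<^sub>R a) = 1" "star (?s *\<^sub>R a) = ?s *\<^sub>R a" using False by (simp_all add: sa)
  then obtain c where c: "c \<in> spectrum (?s *\<^sub>R a)" "1 \<le> cmod c"
    using spectral_radius_self_adjoint by blast
  have "of_real (norm a) * c \<in> spectrum a"
  proof (rule ccontr)
    assume "of_real (norm a) * c \<notin> spectrum a"
    then have "(a - (of_real (norm a) * c) *\<^sub>C 1) dvd 1" by (simp add: spectrum_iff_not_dvd)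
    moreover have "(of_real ?s *\<^sub>C 1) dvd (1 :: 'a)"
      by (rule scaleC_1_dvd_one) (use False in simp)
    ultimately have "(of_real ?s *\<^sub>C 1) * (a - (of_real (norm a) * c) *\<^sub>C 1) dvd 1"
      by (rule mult_dvd_one[rotated])
    also have "(of_real ?s *\<^sub>C 1) * (a - (of_real (norm a) * c) *\<^sub>C 1) = ?s *\<^sub>R a - c *\<^sub>C 1"
      using False by (simp add: mult_scaleC_left scaleC_diff_right scaleC_scaleC scaleR_scaleC
          flip: mult.assoc)
    finally show False using c by (simp add: spectrum_iff_not_dvd)
  qed
  from le[OF this] have "norm a * cmod c \<le> r" by (simp add: norm_mult)
  then show ?thesis using c mult_left_mono[of 1 "cmod c" "norm a"] by simp
qed (use \<open>0 \<le> r\<close> in simp)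

section \<open>The positive cone\<close>

lemma cstar_positive_star: "cstar_positive a \<Longrightarrow> star a = a"
  by (simp add: cstar_positive_def)

text \<open>The spectrum of \<open>a\<close> is real and lies in the disc of radius \<open>s\<close>
  about \<open>s\<close>, which meets the real axis only in nonnegative numbers.\<close>

lemma cstar_positiveI_norm:
  fixes a :: "'a::{unital_cstar_algebra, comm_ring_1}"
  assumes "star a = a" and "norm (s *\<^sub>R 1 - a) \<le> s"
  shows "cstar_positive a"
  unfolding cstar_positive_def
proof (intro conjI subsetI)
  fix c assume c: "c \<in> spectrum a"
  then have real: "c \<in> \<real>" using assms(1) spectrum_self_adjoint_real by blast
  have "cmod (of_real s - c) \<le> s"
    using spectrum_norm_le[of "of_real s - c" "s *\<^sub>R 1 - a"] c assms(2)
    by (simp add: spectrum_scaleR_diff)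
  then have "s - Re c \<le> s" using complex_Re_le_cmod[of "of_real s - c"] by simp
  then show "c \<in> \<real>\<^sub>\<ge>\<^sub>0" using real by (auto simp: complex_nonneg_Reals_iff complex_is_Real_iff)
qed fact

text \<open>Converse of the norm criterion: the spectrum of \<open>a\<close> lies between
  \<open>0\<close> and \<open>s\<close>, hence so does that of \<open>s *\<^sub>R 1 - a\<close>, and
  the spectrum bounds the norm.\<close>

lemma norm_diff_le_of_positive:
  fixes a :: "'a::{unital_cstar_algebra, comm_ring_1}"
  assumes a: "cstar_positive a" and s: "norm a \<le> s"
  shows "norm (s *\<^sub>R 1 - a) \<le> s"
proof (rule norm_le_of_spectrum)
  show "star (s *\<^sub>R 1 - a) = s *\<^sub>R 1 - a" using a by (simp add: cstar_positive_star)
  show "0 \<le> s" using s norm_ge_zero order_trans by blast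
  fix c assume "c \<in> spectrum (s *\<^sub>R 1 - a)"
  then have *: "of_real s - c \<in> spectrum a" using spectrum_scaleR_diff[of s "of_real s - c" a] by simp
  then have "of_real s - c \<in> \<real>\<^sub>\<ge>\<^sub>0" using a by (auto simp: cstar_positive_def)
  moreover have "cmod (of_real s - c) \<le> s" using spectrum_norm_le[OF *] s by simp
  ultimately have "Im c = 0" "Re c \<le> s" "\<bar>s - Re c\<bar> \<le> s"
    using complex_eq_iff abs_Re_le_cmod[of "of_real s - c"]
    by (auto simp: complex_nonneg_Reals_iff)
  then show "cmod c \<le> s" by (simp add: cmod_def)
qed

text \<open>Both conditions on the right are continuous in \<open>a\<close>, unlike the spectral
  definition; closedness of the cone follows at once.\<close>

lemma cstar_positive_iff_norm:
  fixes a :: "'a::{unital_cstar_algebra, comm_ring_1}"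
  shows "cstar_positive a \<longleftrightarrow> star a = a \<and> norm (norm a *\<^sub>R 1 - a) \<le> norm a"
  using cstar_positiveI_norm[of a] norm_diff_le_of_positive[of a] cstar_positive_star[of a] by auto

lemma closed_cstar_positive:
  "closed {a :: 'a::{unital_cstar_algebra, comm_ring_1}. cstar_positive a}"
  unfolding cstar_positive_iff_norm
  by (intro closed_Collect_conj closed_Collect_eq closed_Collect_le continuous_intros
      linear_continuous_on bounded_linear_star)

lemma cstar_positive_0 [simp]: "cstar_positive (0 :: 'a::{unital_cstar_algebra, comm_ring_1})"
  by (simp add: cstar_positive_iff_norm)

lemma cstar_positive_add:
  fixes a b :: "'a::{unital_cstar_algebra, comm_ring_1}"
  assumes "cstar_positive a" "cstar_positive b"
  shows "cstar_positive (a + b)"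
proof (rule cstar_positiveI_norm)
  show "star (a + b) = a + b" using assms by (simp add: star_add cstar_positive_star)
  show "norm ((norm a + norm b) *\<^sub>R 1 - (a + b)) \<le> norm a + norm b"
    using norm_triangle_mono[OF norm_diff_le_of_positive[OF assms(1) order_refl]
        norm_diff_le_of_positive[OF assms(2) order_refl]]
    by (simp add: algebra_simps)
qed

lemma cstar_positive_sum:
  fixes f :: "'i \<Rightarrow> 'a::{unital_cstar_algebra, comm_ring_1}"
  shows "(\<And>i. i \<in> F \<Longrightarrow> cstar_positive (f i)) \<Longrightarrow> cstar_positive (sum f F)"
  by (induction F rule: infinite_finite_induct) (auto intro: cstar_positive_add)

lemma cstar_positive_scaleR:
  fixes a :: "'a::{unital_cstar_algebra, comm_ring_1}"
  assumes "cstar_positive a" "0 \<le> r"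
  shows "cstar_positive (r *\<^sub>R a)"
proof (rule cstar_positiveI_norm)
  show "star (r *\<^sub>R a) = r *\<^sub>R a" using assms by (simp add: cstar_positive_star)
  have "(r * norm a) *\<^sub>R 1 - r *\<^sub>R a = r *\<^sub>R (norm a *\<^sub>R 1 - a)" by (simp add: algebra_simps)
  then show "norm ((r * norm a) *\<^sub>R 1 - r *\<^sub>R a) \<le> r * norm a"
    using norm_diff_le_of_positive[OF assms(1) order_refl] assms(2) by (simp add: mult_left_mono)
qed

lemma cstar_positive_antisym:
  fixes a :: "'a::{unital_cstar_algebra, comm_ring_1}"
  assumes "cstar_positive a" "cstar_positive (- a)"
  shows "a = 0"
proof -
  have "norm a \<le> 0"
  proof (rule norm_le_of_spectrum)
    fix c assume "c \<in> spectrum a"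
    then have "c \<in> \<real>\<^sub>\<ge>\<^sub>0" "- c \<in> \<real>\<^sub>\<ge>\<^sub>0"
      using assms spectrum_uminus[of c a] by (auto simp: cstar_positive_def)
    then show "cmod c \<le> 0" by (auto simp: complex_nonneg_Reals_iff complex_eq_iff)
  qed (use assms in \<open>auto simp: cstar_positive_star\<close>)
  then show ?thesis by simp
qed

text \<open>The comparison passes through the unit: \<open>b\<close> is below
  \<open>norm b *\<^sub>R 1\<close>, hence so is \<open>a\<close>, which confines the spectrum of
  \<open>a\<close> to the interval from \<open>0\<close> to \<open>norm b\<close>.\<close>

lemma norm_mono_positive:
  fixes a b :: "'a::{unital_cstar_algebra, comm_ring_1}"
  assumes a: "cstar_positive a" and ab: "cstar_positive (b - a)"
  shows "norm a \<le> norm b"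
proof -
  have b: "star b = b" using assms cstar_positive_star[of a] cstar_positive_star[of "b - a"] by simp
  have "cstar_positive (norm b *\<^sub>R 1 - b)"
    by (rule cstar_positiveI_norm[where s = "norm b"]) (simp_all add: b)
  then have *: "cstar_positive (norm b *\<^sub>R 1 - a)" using cstar_positive_add ab by fastforce
  show ?thesis
  proof (rule norm_le_of_spectrum)
    show "star a = a" using a by (rule cstar_positive_star)
    fix c assume "c \<in> spectrum a"
    then have "c \<in> \<real>\<^sub>\<ge>\<^sub>0" "of_real (norm b) - c \<in> \<real>\<^sub>\<ge>\<^sub>0"
      using a * spectrum_scaleR_diff[of "norm b" c a] by (auto simp: cstar_positive_def)
    then show "cmod c \<le> norm b" by (auto simp: complex_nonneg_Reals_iff cmod_def)
  qed simp
qed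

text \<open>Factor \<open>u * u - c\<close> over the square roots of \<open>c\<close>: one of them
  lies in the spectrum of \<open>u\<close>, so it is real, and its square \<open>c\<close> is
  nonnegative.\<close>

lemma cstar_positive_square:
  fixes u :: "'a::{unital_cstar_algebra, comm_ring_1}"
  assumes "star u = u"
  shows "cstar_positive (u * u)"
  unfolding cstar_positive_def
proof (intro conjI subsetI)
  fix c assume c: "c \<in> spectrum (u * u)"
  have "(u - csqrt c *\<^sub>C 1) * (u - (- csqrt c) *\<^sub>C 1) = u * u - c *\<^sub>C 1"
    by (simp add: scaleC_minus_left algebra_simps mult_scaleC_left mult_scaleC_right scaleC_scaleC
        flip: power2_eq_square[of "csqrt c"])
  then have "csqrt c \<in> spectrum u \<or> - csqrt c \<in> spectrum u"
    using c mult_dvd_one[of "u - csqrt c *\<^sub>C 1" "u - (- csqrt c) *\<^sub>C 1"]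
    unfolding spectrum_iff_not_dvd by auto
  then have "csqrt c \<in> \<real>" using spectrum_self_adjoint_real[OF assms] by force
  then obtain t where t: "csqrt c = of_real t" by (auto elim: Reals_cases)
  then have "c = of_real (t\<^sup>2)" by (metis of_real_power power2_csqrt)
  then show "c \<in> \<real>\<^sub>\<ge>\<^sub>0" by (simp add: complex_nonneg_Reals_iff)
qed (simp add: assms star_mult)

text \<open>The self-adjoint parts \<open>u\<close>, \<open>v\<close> of
  \<open>a = u + \<i> v\<close> commute, so \<open>a * star a\<close> is the sum of their
  squares.\<close>

lemma cstar_positive_mult_star:
  fixes a :: "'a::{unital_cstar_algebra, comm_ring_1}"
  shows "cstar_positive (a * star a)"
proof -
  define u v where "u = (1/2) *\<^sub>R (a + star a)" and "v = (- \<i> / 2) *\<^sub>C (a - star a)"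
  have "star u = u" "star v = v"
    by (simp_all add: u_def v_def star_add star_star star_scaleC scaleC_diff_right scaleC_minus_left
        add.commute)
  moreover have "a * star a = u * u + v * v"
  proof -
    have "v * v = - ((1/4) *\<^sub>R ((a - star a) * (a - star a)))"
      by (simp add: v_def mult_scaleC_left mult_scaleC_right scaleC_scaleC scaleR_scaleC
          scaleC_minus_left scaleC_minus_right)
    moreover have "u * u = (1/4) *\<^sub>R ((a + star a) * (a + star a))"
      by (simp add: u_def)
    ultimately have "4 *\<^sub>R (u * u + v * v) = (a + star a) * (a + star a) - (a - star a) * (a - star a)"
      by (simp add: scaleR_diff_right)
    also have "\<dots> = 4 *\<^sub>R (a * star a)"
      using scaleR_add_left[of 2 2 "a * star a"] by (simp add: scaleR_2 algebra_simps)
    finally show ?thesis by simp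
  qed
  ultimately show ?thesis by (auto intro: cstar_positive_add cstar_positive_square)
qed

section \<open>Calculus of the order on the algebra\<close>

lemma numeral_mult_eq_scaleR: "numeral w * a = numeral w *\<^sub>R (a :: 'a::real_algebra_1)"
  by (simp add: scaleR_conv_of_real)

lemma cstar_le_refl [simp]: "(a :: 'a::{unital_cstar_algebra, comm_ring_1}) \<le>\<^sub>A a"
  by (simp add: cstar_le_def)

lemma cstar_le_trans [trans]:
  fixes a b c :: "'a::{unital_cstar_algebra, comm_ring_1}"
  assumes "a \<le>\<^sub>A b" "b \<le>\<^sub>A c"
  shows "a \<le>\<^sub>A c"
  using cstar_positive_add[of "b - a" "c - b"] assms by (simp add: cstar_le_def)

lemma cstar_le_antisym:
  fixes a b :: "'a::{unital_cstar_algebra, comm_ring_1}"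
  assumes "a \<le>\<^sub>A b" "b \<le>\<^sub>A a"
  shows "a = b"
  using cstar_positive_antisym[of "b - a"] assms by (simp add: cstar_le_def)

lemma cstar_le_add_mono:
  fixes a b c d :: "'a::{unital_cstar_algebra, comm_ring_1}"
  assumes "a \<le>\<^sub>A b" "c \<le>\<^sub>A d"
  shows "a + c \<le>\<^sub>A b + d"
  using cstar_positive_add[of "b - a" "d - c"] assms by (simp add: cstar_le_def algebra_simps)

lemma cstar_le_scaleR_mono:
  fixes a b :: "'a::{unital_cstar_algebra, comm_ring_1}"
  assumes "a \<le>\<^sub>A b" "0 \<le> r"
  shows "r *\<^sub>R a \<le>\<^sub>A r *\<^sub>R b"
  using cstar_positive_scaleR[of "b - a" r] assms by (simp add: cstar_le_def scaleR_diff_right)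

lemma cstar_le_norm_mono:
  fixes a b :: "'a::{unital_cstar_algebra, comm_ring_1}"
  assumes "cstar_positive a" "a \<le>\<^sub>A b"
  shows "norm a \<le> norm b"
  using norm_mono_positive assms by (simp add: cstar_le_def)

lemma cstar_le_scaleR_left_mono:
  fixes a :: "'a::{unital_cstar_algebra, comm_ring_1}"
  assumes "cstar_positive a" "r \<le> s"
  shows "r *\<^sub>R a \<le>\<^sub>A s *\<^sub>R a"
  using cstar_positive_scaleR[of a "s - r"] assms by (simp add: cstar_le_def scaleR_diff_left)

text \<open>The difference of the two sides is \<open>1 / t\<close> times
  \<open>(t *\<^sub>R a - b) * star (t *\<^sub>R a - b)\<close>.\<close>

lemma cstar_young:
  fixes a b :: "'a::{unital_cstar_algebra, comm_ring_1}"
  assumes "0 < t"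
  shows "a * star b + b * star a \<le>\<^sub>A t *\<^sub>R (a * star a) + (1 / t) *\<^sub>R (b * star b)"
proof -
  have "t *\<^sub>R (a * star a) + (1 / t) *\<^sub>R (b * star b) - (a * star b + b * star a) =
      (1 / t) *\<^sub>R ((t *\<^sub>R a - b) * star (t *\<^sub>R a - b))"
    using assms by (simp add: algebra_simps)
  then show ?thesis
    using assms cstar_positive_scaleR[OF cstar_positive_mult_star, of "1 / t" "t *\<^sub>R a - b"]
    by (simp add: cstar_le_def)
qed

lemma cstar_le_sum_mono:
  fixes f g :: "'i \<Rightarrow> 'a::{unital_cstar_algebra, comm_ring_1}"
  assumes "\<And>i. i \<in> F \<Longrightarrow> f i \<le>\<^sub>A g i"
  shows "sum f F \<le>\<^sub>A sum g F"
  using assms cstar_positive_sum[of F "\<lambda>i. g i - f i"] by (simp add: cstar_le_def sum_subtractf)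

text \<open>The negative of one summand is the sum of the others, so the summand is positive and
  negative at once.\<close>

lemma cstar_positive_sum_eq_0:
  fixes f :: "'i \<Rightarrow> 'a::{unital_cstar_algebra, comm_ring_1}"
  assumes "finite F" "\<And>i. i \<in> F \<Longrightarrow> cstar_positive (f i)" "sum f F = 0" "i \<in> F"
  shows "f i = 0"
proof (rule cstar_positive_antisym)
  have "- f i = sum f (F - {i})"
    using assms(1,3,4) by (simp add: sum.remove[of F i] eq_neg_iff_add_eq_0 neg_eq_iff_add_eq_0)
  then show "cstar_positive (- f i)" using assms(2) by (auto intro: cstar_positive_sum)
qed (use assms in blast)

lemma cstar_positive_has_sum:
  fixes f :: "'i \<Rightarrow> 'a::{unital_cstar_algebra, comm_ring_1}"
  assumes "(f has_sum s) J" "\<And>i. i \<in> J \<Longrightarrow> cstar_positive (f i)"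
  shows "cstar_positive s"
proof -
  have "s \<in> {a. cstar_positive a}"
  proof (rule Lim_in_closed_set[OF closed_cstar_positive])
    show "(sum f \<longlongrightarrow> s) (finite_subsets_at_top J)" using assms(1) by (simp add: has_sum_def)
    show "\<forall>\<^sub>F F in finite_subsets_at_top J. sum f F \<in> {a. cstar_positive a}"
      by (rule eventually_finite_subsets_at_top_weakI) (use assms(2) in \<open>auto intro: cstar_positive_sum\<close>)
  qed simp
  then show ?thesis by simp
qed

lemma sum_cstar_le_infsum:
  fixes f :: "'i \<Rightarrow> 'a::{unital_cstar_algebra, comm_ring_1}"
  assumes "f summable_on J" "\<And>i. i \<in> J \<Longrightarrow> cstar_positive (f i)" "finite F" "F \<subseteq> J"
  shows "sum f F \<le>\<^sub>A infsum f J"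
proof -
  have "(f has_sum (infsum f J - sum f F)) (J - F)"
    using assms by (intro has_sum_Diff) auto
  then show ?thesis unfolding cstar_le_def
    by (rule cstar_positive_has_sum) (use assms(2) in auto)
qed


section \<open>Self-adjoint operators on a Hilbert module\<close>

context hilbert_module
begin

lemma ip_add_right: "ip x (y + z) = ip x y + ip x z"
  by (metis ip_add_left ip_star star_add)

lemma ip_smul_right: "ip x (smul a y) = star a * ip x y"
  by (metis ip_smul_left ip_star star_mult mult.commute)

lemma ip_scaleR_left: "ip (r *\<^sub>R x) y = r *\<^sub>R ip x y"
  by (simp add: scaleR_eq ip_smul_left)

lemma ip_scaleR_right: "ip x (r *\<^sub>R y) = r *\<^sub>R ip x y"
  by (simp add: scaleR_eq ip_smul_right)

lemma ip_0_left [simp]: "ip 0 y = 0"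
  using ip_add_left[of 0 0 y] by simp

lemma ip_0_right [simp]: "ip x 0 = 0"
  using ip_add_right[of x 0 0] by simp

lemma ip_minus_left: "ip (- x) y = - ip x y"
  using ip_add_left[of "- x" x y] by (simp add: eq_neg_iff_add_eq_0)

lemma ip_minus_right: "ip x (- y) = - ip x y"
  using ip_add_right[of x "- y" y] by (simp add: eq_neg_iff_add_eq_0)

lemma ip_diff_left: "ip (x - y) z = ip x z - ip y z"
  using ip_add_left[of x "- y" z] by (simp add: ip_minus_left)

lemma ip_diff_right: "ip x (y - z) = ip x y - ip x z"
  using ip_add_right[of x y "- z"] by (simp add: ip_minus_right)

lemma ip_sum_left: "ip (sum f F) y = (\<Sum>i\<in>F. ip (f i) y)"
  by (induction F rule: infinite_finite_induct) (simp_all add: ip_add_left)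

lemmas ip_simps = ip_add_left ip_add_right ip_diff_left ip_diff_right ip_minus_left ip_minus_right
  ip_scaleR_left ip_scaleR_right

lemma norm_ip_self: "norm (ip x x) = (norm x)\<^sup>2"
  by (simp add: norm_eq)

lemma ip_eqI:
  assumes "\<And>z. ip x z = ip y z"
  shows "x = y"
  using ip_definite[of "x - y"] assms by (simp add: ip_diff_left)

lemma ip_self_eq_0_iff [simp]: "ip x x = 0 \<longleftrightarrow> x = 0"
  using ip_definite by auto

lemma ip_young:
  assumes "0 < t"
  shows "ip x y + ip y x \<le>\<^sub>A t *\<^sub>R ip x x + (1 / t) *\<^sub>R ip y y"
proof -
  have "t *\<^sub>R ip x x + (1 / t) *\<^sub>R ip y y - (ip x y + ip y x) =
      (1 / t) *\<^sub>R ip (t *\<^sub>R x - y) (t *\<^sub>R x - y)"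
    using assms by (simp add: ip_simps algebra_simps)
  then show ?thesis using assms cstar_positive_scaleR[OF ip_positive] by (simp add: cstar_le_def)
qed

text \<open>Cauchy-Schwarz: apply Young's inequality to \<open>smul \<langle>x, y\<rangle> y\<close> and \<open>x\<close>.\<close>

lemma norm_ip_le: "norm (ip x y) \<le> norm x * norm y"
proof (cases "y = 0")
  case False
  define a where "a = ip x y"
  \<comment> \<open>With this weight the second Young term has norm at most
    \<open>norm (a * star a)\<close>, half of the left-hand side, and can be absorbed.\<close>
  define t where "t = (norm y)\<^sup>2"
  have t: "t > 0" using False by (simp add: t_def)
  have ax: "ip x (smul a y) = a * star a"
    by (simp add: ip_smul_right a_def mult.commute)
  moreover have "ip (smul a y) x = a * star a"
    by (subst ip_star) (simp add: ax star_mult star_star)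
  moreover have "ip (smul a y) (smul a y) = a * star a * ip y y"
    by (simp add: ip_smul_left ip_smul_right mult.assoc)
  ultimately have "2 *\<^sub>R (a * star a) \<le>\<^sub>A t *\<^sub>R ip x x + (1 / t) *\<^sub>R (a * star a * ip y y)"
    using ip_young[OF t, of x "smul a y"] by (simp add: scaleR_2)
  then have "norm (2 *\<^sub>R (a * star a)) \<le> norm (t *\<^sub>R ip x x + (1 / t) *\<^sub>R (a * star a * ip y y))"
    by (rule cstar_le_norm_mono[rotated]) (simp add: cstar_positive_scaleR cstar_positive_mult_star)
  also have "\<dots> \<le> norm (t *\<^sub>R ip x x) + norm ((1 / t) *\<^sub>R (a * star a * ip y y))"
    by (rule norm_triangle_ineq)
  also have "norm (t *\<^sub>R ip x x) = t * (norm x)\<^sup>2" using t by (simp add: norm_ip_self)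
  also have "norm ((1 / t) *\<^sub>R (a * star a * ip y y)) \<le> (1 / t) * (norm (a * star a) * t)"
    using t norm_mult_ineq[of "a * star a" "ip y y"]
    by (simp add: norm_ip_self t_def pos_divide_le_eq)
  also have "\<dots> = norm (a * star a)" using t by simp
  finally have "norm (a * star a) \<le> t * (norm x)\<^sup>2" by simp
  moreover have "norm (a * star a) = (norm a)\<^sup>2"
    using cstar_identity[of a] by (simp add: mult.commute)
  ultimately have "(norm a)\<^sup>2 \<le> (norm x * norm y)\<^sup>2" by (simp add: t_def power_mult_distrib mult.commute)
  then show ?thesis unfolding a_def by (rule power2_le_imp_le) simp
qed simp

lemma bounded_bilinear_ip: "bounded_bilinear ip"
  by unfold_locales (use norm_ip_le in \<open>auto simp: ip_simps intro!: exI[of _ 1]\<close>)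

section \<open>Adjointable operators: bounds, inverses and square roots\<close>

lemma is_adjoint_add: "is_adjoint ip T T' \<Longrightarrow> T (x + y) = T x + T y"
  by (rule ip_eqI) (simp add: is_adjoint_def ip_add_left)

lemma is_adjoint_scaleR: "is_adjoint ip T T' \<Longrightarrow> T (r *\<^sub>R x) = r *\<^sub>R T x"
  by (rule ip_eqI) (simp add: is_adjoint_def ip_scaleR_left)

lemma is_adjoint_diff: "is_adjoint ip T T' \<Longrightarrow> T (x - y) = T x - T y"
  by (rule ip_eqI) (simp add: is_adjoint_def ip_diff_left)

lemma norm_le_of_ip_le:
  assumes "ip y y \<le>\<^sub>A c\<^sup>2 *\<^sub>R ip x x" "0 \<le> c"
  shows "norm y \<le> c * norm x"
proof -
  have "(norm y)\<^sup>2 \<le> (c * norm x)\<^sup>2"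
    using cstar_le_norm_mono[OF ip_positive assms(1)] by (simp add: norm_ip_self power_mult_distrib)
  then show ?thesis by (rule power2_le_imp_le) (use assms(2) in simp)
qed

lemma bounded_linear_of_adjoint:
  assumes "is_adjoint ip T T'" "\<And>x. ip (T x) (T x) \<le>\<^sub>A c\<^sup>2 *\<^sub>R ip x x" "0 \<le> c"
  shows "bounded_linear T"
  by (rule bounded_linear_intro[where K = c])
     (use assms norm_le_of_ip_le in
       \<open>auto simp: is_adjoint_add is_adjoint_scaleR mult.commute\<close>)

text \<open>The difference \<open>D T - T\<^sup>2\<close> is \<open>(T (D - T) T + (D - T) T (D - T)) / D\<close>.\<close>

lemma ip_square_le:
  assumes adj: "is_adjoint ip T T" and pos: "\<And>x. cstar_positive (ip (T x) x)"
    and le: "\<And>x. ip (T x) x \<le>\<^sub>A D *\<^sub>R ip x x" and D: "0 < D"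
  shows "ip (T x) (T x) \<le>\<^sub>A D *\<^sub>R ip (T x) x"
proof -
  note lin = is_adjoint_diff[OF adj] is_adjoint_scaleR[OF adj]
  have sym: "ip u (T v) = ip (T u) v" for u v using adj by (simp add: is_adjoint_def)
  define y where "y = D *\<^sub>R x - T x"
  have "cstar_positive (D *\<^sub>R ip (T x) (T x) - ip (T (T x)) (T x))"
    using le[of "T x"] by (simp add: cstar_le_def)
  moreover have "cstar_positive (ip (T y) y)" by (rule pos)
  ultimately have "cstar_positive ((1 / D) *\<^sub>R (D *\<^sub>R ip (T x) (T x) - ip (T (T x)) (T x) + ip (T y) y))"
    using D by (intro cstar_positive_scaleR cstar_positive_add) auto
  also have "(1 / D) *\<^sub>R (D *\<^sub>R ip (T x) (T x) - ip (T (T x)) (T x) + ip (T y) y) =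
      D *\<^sub>R ip (T x) x - ip (T x) (T x)"
    using D by (simp add: y_def lin ip_simps sym algebra_simps)
  finally show ?thesis by (simp add: cstar_le_def)
qed

text \<open>For large \<open>M\<close> the operator \<open>1 - S / M\<close> is positive with
  quadratic form at most \<open>r\<close>; \<open>ip_square_le\<close> upgrades this to a bound on
  its square.\<close>

lemma contraction_of_bounds:
  assumes adj: "is_adjoint ip S S" and C: "0 < C"
    and lower: "\<And>x. C *\<^sub>R ip x x \<le>\<^sub>A ip (S x) x" and upper: "\<And>x. ip (S x) x \<le>\<^sub>A D *\<^sub>R ip x x"
  obtains M r where "0 < M" "0 < r" "r < 1"
    "\<And>x. ip (x - (1 / M) *\<^sub>R S x) (x - (1 / M) *\<^sub>R S x) \<le>\<^sub>A r\<^sup>2 *\<^sub>R ip x x"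
proof
  define M where "M = max C D"
  \<comment> \<open>The factor \<open>2\<close> keeps \<open>r \<ge> 1/2\<close>. Without it
    \<open>r\<close> would vanish for \<open>M = C\<close>, while \<open>ip_square_le\<close> and
    the root construction need a positive \<open>r\<close>.\<close>
  define k where "k = C / (2 * M)"
  define r where "r = 1 - k"
  define T where "T = (\<lambda>x. x - (1 / M) *\<^sub>R S x)"
  have M: "0 < M" "D \<le> M" "C \<le> M" using C by (auto simp: M_def)
  then have k: "0 < k" "k \<le> 1/2" "C = M * (k + k)" using C by (auto simp: k_def field_simps)
  then have r: "0 < r" "r < 1" by (auto simp: r_def)
  show "0 < M" "0 < r" "r < 1" by fact+
  have adjT: "is_adjoint ip T T" using adj by (simp add: is_adjoint_def T_def ip_simps)
  have posT: "cstar_positive (ip (T x) x)" for x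
  proof -
    have "ip (S x) x \<le>\<^sub>A M *\<^sub>R ip x x"
      using upper[of x] cstar_le_scaleR_left_mono[OF ip_positive M(2)] cstar_le_trans by blast
    then have "cstar_positive ((1 / M) *\<^sub>R (M *\<^sub>R ip x x - ip (S x) x))"
      using M by (intro cstar_positive_scaleR) (auto simp: cstar_le_def)
    then show ?thesis using M by (simp add: T_def ip_simps scaleR_diff_right)
  qed
  have leT: "ip (T x) x \<le>\<^sub>A r *\<^sub>R ip x x" for x
  proof -
    have "cstar_positive ((1 / M) *\<^sub>R (ip (S x) x - C *\<^sub>R ip x x) + k *\<^sub>R ip x x)"
      using M k lower[of x]
      by (intro cstar_positive_add cstar_positive_scaleR ip_positive) (auto simp: cstar_le_def)
    also have "(1 / M) *\<^sub>R (ip (S x) x - C *\<^sub>R ip x x) + k *\<^sub>R ip x x = r *\<^sub>R ip x x - ip (T x) x"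
      using M k(3) by (simp add: T_def r_def ip_simps numeral_mult_eq_scaleR algebra_simps)
    finally show ?thesis by (simp add: cstar_le_def)
  qed
  show "ip (x - (1 / M) *\<^sub>R S x) (x - (1 / M) *\<^sub>R S x) \<le>\<^sub>A r\<^sup>2 *\<^sub>R ip x x" for x
    using cstar_le_trans[OF ip_square_le[OF adjT posT leT r(1), of x]
        cstar_le_scaleR_mono[OF leT[of x], of r]] r(1)
    by (simp add: T_def power2_eq_square)
qed

text \<open>Solving \<open>S x = y\<close> is a fixed point problem for the contraction
  \<open>x - S x / M + y / M\<close>.\<close>

lemma bij_of_bounds:
  assumes adj: "is_adjoint ip S S" and C: "0 < C"
    and lower: "\<And>x. C *\<^sub>R ip x x \<le>\<^sub>A ip (S x) x" and upper: "\<And>x. ip (S x) x \<le>\<^sub>A D *\<^sub>R ip x x"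
  shows "bij S"
proof -
  obtain M r where M: "0 < M" and r: "0 < r" "r < 1"
    and le: "\<And>x. ip (x - (1 / M) *\<^sub>R S x) (x - (1 / M) *\<^sub>R S x) \<le>\<^sub>A r\<^sup>2 *\<^sub>R ip x x"
    using contraction_of_bounds[OF assms] by metis
  show ?thesis
  proof (rule bijI')
    fix x y
    have "x = y" if "S x = S y"
    proof -
      have "S (x - y) = 0" using that by (simp add: is_adjoint_diff[OF adj])
      then have "norm (x - y) \<le> r * norm (x - y)"
        using norm_le_of_ip_le[of "x - y" r "x - y"] le[of "x - y"] r by simp
      then show ?thesis using r by (simp add: mult_le_cancel_right1)
    qed
    then show "S x = S y \<longleftrightarrow> x = y" by auto
  next
    fix y
    define f where "f = (\<lambda>x. x - (1 / M) *\<^sub>R S x + (1 / M) *\<^sub>R y)"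
    have "dist (f x) (f z) \<le> r * dist x z" for x z
    proof -
      have "f x - f z = (x - z) - (1 / M) *\<^sub>R S (x - z)"
        by (simp add: f_def is_adjoint_diff[OF adj] scaleR_diff_right)
      then show ?thesis unfolding dist_norm using norm_le_of_ip_le[OF le] r by simp
    qed
    then obtain x where "f x = x" using banach_fix_type[of r f] r by auto
    then have "(1 / M) *\<^sub>R (y - S x) = 0" by (simp add: f_def algebra_simps)
    then show "\<exists>x. y = S x" using M by auto
  qed
qed

text \<open>With \<open>S = M (1 - T)\<close> and \<open>\<parallel>T\<parallel> < 1\<close>, the root is \<open>sqrt M (1 - Y)\<close> for the fixed point \<open>Y\<close> of
  the contraction \<open>Y \<mapsto> (T + Y\<^sup>2) / 2\<close>. The invariant set of the contraction records what is needed
  of \<open>Y\<close>.\<close>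

lemma exists_sqrt_of_bounds:
  assumes adj: "is_adjoint ip S S" and C: "0 < C"
    and lower: "\<And>x. C *\<^sub>R ip x x \<le>\<^sub>A ip (S x) x" and upper: "\<And>x. ip (S x) x \<le>\<^sub>A D *\<^sub>R ip x x"
  obtains B b where "is_adjoint ip B B" "0 < b" "\<And>x. b *\<^sub>R ip x x \<le>\<^sub>A ip (B x) x" "B \<circ> B = S"
    "\<And>V. bounded_linear V \<Longrightarrow> V \<circ> S = S \<circ> V \<Longrightarrow> V \<circ> B = B \<circ> V"
proof -
  obtain M r where M: "0 < M" and r: "0 < r" "r < 1"
    and le: "\<And>x. ip (x - (1 / M) *\<^sub>R S x) (x - (1 / M) *\<^sub>R S x) \<le>\<^sub>A r\<^sup>2 *\<^sub>R ip x x"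
    using contraction_of_bounds[OF assms] by metis
  define T where "T = (\<lambda>x. x - (1 / M) *\<^sub>R S x)"
  have adjT: "is_adjoint ip T T" using adj by (simp add: is_adjoint_def T_def ip_simps)
  have leT: "ip (T x) (T x) \<le>\<^sub>A r\<^sup>2 *\<^sub>R ip x x" for x using le by (simp add: T_def)
  have blT: "bounded_linear T" using bounded_linear_of_adjoint[OF adjT leT] r by simp
  define T' where "T' = Blinfun T"
  have T': "blinfun_apply T' x = T x" for x
    unfolding T'_def by (simp add: bounded_linear_Blinfun_apply blT)
  define K where "K = {Y :: 'h \<Rightarrow>\<^sub>L 'h.
    (\<forall>x y. ip (Y x) y = ip x (Y y)) \<and>
    (\<forall>x. cstar_positive (r\<^sup>2 *\<^sub>R ip x x - ip (Y x) (Y x))) \<and>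
    (\<forall>V. bounded_linear V \<and> V \<circ> S = S \<circ> V \<longrightarrow> (\<forall>x. Y (V x) = V (Y x)))}"
  have K_adj: "ip (Y x) y = ip x (Y y)" and K_le: "ip (Y x) (Y x) \<le>\<^sub>A r\<^sup>2 *\<^sub>R ip x x"
    and K_comm: "\<And>V. bounded_linear V \<Longrightarrow> V \<circ> S = S \<circ> V \<Longrightarrow> Y (V x) = V (Y x)"
    if "Y \<in> K" for Y x y
    using that by (auto simp: K_def cstar_le_def)
  have K_norm: "norm Y \<le> r" if "Y \<in> K" for Y
    using norm_le_of_ip_le[OF K_le[OF that]] r by (intro norm_blinfun_bound) auto
  have "closed K"
  proof -
    have cont: "continuous_on UNIV (\<lambda>Y :: 'h \<Rightarrow>\<^sub>L 'h. Y x)" for x by (intro continuous_intros)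
    note cont_ip = bounded_bilinear.continuous_on[OF bounded_bilinear_ip]
    have "closed {Y :: 'h \<Rightarrow>\<^sub>L 'h. cstar_positive (r\<^sup>2 *\<^sub>R ip x x - ip (Y x) (Y x))}" for x
      using closed_vimage[OF closed_cstar_positive,
          of "\<lambda>Y :: 'h \<Rightarrow>\<^sub>L 'h. r\<^sup>2 *\<^sub>R ip x x - ip (Y x) (Y x)"]
      by (simp add: vimage_def continuous_on_diff cont_ip cont)
    moreover have "closed {Y :: 'h \<Rightarrow>\<^sub>L 'h. bounded_linear V \<and> V \<circ> S = S \<circ> V \<longrightarrow> (\<forall>x. Y (V x) = V (Y x))}"
      for V
    proof (cases "bounded_linear V \<and> V \<circ> S = S \<circ> V")
      case True
      then have "closed {Y :: 'h \<Rightarrow>\<^sub>L 'h. \<forall>x. Y (V x) = V (Y x)}"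
        by (intro closed_Collect_all closed_Collect_eq cont) (auto intro: bounded_linear.continuous_on cont)
      then show ?thesis using True by simp
    qed (simp only: simp_thms Collect_const closed_UNIV if_True)
    ultimately show ?thesis unfolding K_def
      by (intro closed_Collect_conj closed_Collect_all closed_Collect_eq cont_ip cont
          continuous_on_const)
  qed
  have adjT_apply: "ip (T x) y = ip x (T y)" for x y using adjT by (simp add: is_adjoint_def)
  define F where "F = (\<lambda>Y :: 'h \<Rightarrow>\<^sub>L 'h. (1/2) *\<^sub>R (T' + (Y o\<^sub>L Y)))"
  have F_apply: "F Y x = (1/2) *\<^sub>R (T x + Y (Y x))" for Y x
    by (simp add: F_def T' blinfun.scaleR_left blinfun.add_left)
  have F_K: "F Y \<in> K" if Y: "Y \<in> K" for Y
    unfolding K_def mem_Collect_eq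
  proof (intro conjI allI impI)
    show "ip (F Y x) y = ip x (F Y y)" for x y
      by (simp add: F_apply ip_simps adjT_apply K_adj[OF Y])
    fix x
    have YY: "ip (Y (Y x)) (Y (Y x)) \<le>\<^sub>A (r\<^sup>2 * r\<^sup>2) *\<^sub>R ip x x"
      using cstar_le_trans[OF K_le[OF Y, of "Y x"] cstar_le_scaleR_mono[OF K_le[OF Y, of x]]] by simp
    have "ip (T x + Y (Y x)) (T x + Y (Y x)) =
        ip (T x) (T x) + ip (Y (Y x)) (Y (Y x)) + (ip (T x) (Y (Y x)) + ip (Y (Y x)) (T x))"
      by (simp add: ip_simps algebra_simps)
    \<comment> \<open>The weight \<open>r\<close> balances the sizes \<open>r\<close> of
      \<open>T\<close> and \<open>r\<^sup>2\<close> of \<open>Y\<^sup>2\<close>, so the total is the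
      perfect square \<open>r\<^sup>2 * (1 + r)\<^sup>2\<close>, below
      \<open>4 * r\<^sup>2\<close>.\<close>
    also have "\<dots> \<le>\<^sub>A ip (T x) (T x) + ip (Y (Y x)) (Y (Y x)) +
        (r *\<^sub>R ip (T x) (T x) + (1 / r) *\<^sub>R ip (Y (Y x)) (Y (Y x)))"
      by (intro cstar_le_add_mono cstar_le_refl ip_young r)
    also have "\<dots> \<le>\<^sub>A r\<^sup>2 *\<^sub>R ip x x + (r\<^sup>2 * r\<^sup>2) *\<^sub>R ip x x +
        (r *\<^sub>R r\<^sup>2 *\<^sub>R ip x x + (1 / r) *\<^sub>R (r\<^sup>2 * r\<^sup>2) *\<^sub>R ip x x)"
      using r by (intro cstar_le_add_mono cstar_le_scaleR_mono leT YY) auto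
    also have "\<dots> = (r\<^sup>2 * (1 + r)\<^sup>2) *\<^sub>R ip x x"
      using r by (simp add: power2_eq_square algebra_simps flip: scaleR_left_distrib)
    also have "\<dots> \<le>\<^sub>A (r\<^sup>2 * 2\<^sup>2) *\<^sub>R ip x x"
      using r by (intro cstar_le_scaleR_left_mono ip_positive mult_left_mono power_mono) auto
    finally have "(1/4) *\<^sub>R ip (T x + Y (Y x)) (T x + Y (Y x)) \<le>\<^sub>A (1/4) *\<^sub>R (r\<^sup>2 * 2\<^sup>2) *\<^sub>R ip x x"
      by (rule cstar_le_scaleR_mono) simp
    then show "cstar_positive (r\<^sup>2 *\<^sub>R ip x x - ip (F Y x) (F Y x))"
      unfolding F_apply ip_scaleR_left ip_scaleR_right by (simp add: cstar_le_def)
  next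
    fix V assume V: "bounded_linear V \<and> V \<circ> S = S \<circ> V"
    then interpret V: bounded_linear V by simp
    fix x
    have "S (V x) = V (S x)" using V by (metis comp_apply)
    then show "F Y (V x) = V (F Y x)"
      using K_comm[OF Y, of V] V by (simp add: F_apply T_def V.scaleR V.add V.diff)
  qed
  have "dist (F Y) (F Z) \<le> r * dist Y Z" if "Y \<in> K" "Z \<in> K" for Y Z
  proof -
    \<comment> \<open>This splitting of \<open>Y\<^sup>2 - Z\<^sup>2\<close> does not require
      \<open>Y\<close> and \<open>Z\<close> to commute.\<close>
    have "F Y - F Z = (1/2) *\<^sub>R ((Y o\<^sub>L (Y - Z)) + ((Y - Z) o\<^sub>L Z))"
      by (rule blinfun_eqI)
         (simp add: F_def blinfun.scaleR_left blinfun.add_left blinfun.diff_left blinfun.diff_right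
           algebra_simps)
    then have "dist (F Y) (F Z) = (1/2) * norm ((Y o\<^sub>L (Y - Z)) + ((Y - Z) o\<^sub>L Z))"
      by (simp add: dist_norm)
    also have "\<dots> \<le> (1/2) * (norm Y * norm (Y - Z) + norm (Y - Z) * norm Z)"
      by (intro mult_left_mono norm_triangle_mono norm_blinfun_compose) auto
    also have "\<dots> \<le> (1/2) * (r * norm (Y - Z) + norm (Y - Z) * r)"
      using K_norm that by (intro mult_left_mono add_mono mult_right_mono) auto
    finally show ?thesis by (simp add: dist_norm)
  qed
  then have "\<forall>Y\<in>K. \<forall>Z\<in>K. dist (F Y) (F Z) \<le> r * dist Y Z" by blast
  moreover have "0 \<in> K"
    using r by (auto simp: K_def linear_0 bounded_linear.linear intro: cstar_positive_scaleR ip_positive)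
  moreover have "complete K" using \<open>closed K\<close> by (simp add: complete_eq_closed)
  ultimately obtain Y where Y: "Y \<in> K" "F Y = Y"
    using Banach_fix[of K r F] r F_K by (metis empty_iff image_subsetI less_imp_le)
  \<comment> \<open>The fixed point equation, solved for \<open>Y\<^sup>2\<close>; it says that
    \<open>1 - Y\<close> squares to \<open>1 - T\<close>.\<close>
  have YY: "Y (Y x) = 2 *\<^sub>R Y x - T x" for x
  proof -
    have "2 *\<^sub>R Y x = 2 *\<^sub>R F Y x" by (simp add: Y)
    then show ?thesis by (simp add: F_apply)
  qed
  define B where "B = (\<lambda>x. sqrt M *\<^sub>R (x - Y x))"
  show thesis
  proof (rule that[of B "sqrt M * (1 - r)"])
    show "is_adjoint ip B B" by (simp add: is_adjoint_def B_def ip_simps K_adj[OF Y(1)])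
    show "0 < sqrt M * (1 - r)" using M r by simp
    show "(sqrt M * (1 - r)) *\<^sub>R ip x x \<le>\<^sub>A ip (B x) x" for x
    proof -
      \<comment> \<open>Young's inequality turns the bound on \<open>Y\<^sup>2\<close> into
        \<open>Y \<le> r\<close> as a quadratic form, hence
        \<open>1 - Y \<ge> 1 - r\<close>.\<close>
      have "2 *\<^sub>R ip (Y x) x = ip x (Y x) + ip (Y x) x" by (simp add: K_adj[OF Y(1)] scaleR_2)
      also have "\<dots> \<le>\<^sub>A r *\<^sub>R ip x x + (1 / r) *\<^sub>R ip (Y x) (Y x)" by (rule ip_young[OF r(1)])
      also have "\<dots> \<le>\<^sub>A r *\<^sub>R ip x x + (1 / r) *\<^sub>R r\<^sup>2 *\<^sub>R ip x x"
        using r by (intro cstar_le_add_mono cstar_le_scaleR_mono K_le[OF Y(1)]) auto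
      also have "\<dots> = 2 *\<^sub>R r *\<^sub>R ip x x" using r by (simp add: power2_eq_square flip: scaleR_left_distrib)
      finally have "cstar_positive ((sqrt M / 2) *\<^sub>R (2 *\<^sub>R r *\<^sub>R ip x x - 2 *\<^sub>R ip (Y x) x))"
        using M by (intro cstar_positive_scaleR) (auto simp: cstar_le_def)
      also have "(sqrt M / 2) *\<^sub>R (2 *\<^sub>R r *\<^sub>R ip x x - 2 *\<^sub>R ip (Y x) x) =
          ip (B x) x - (sqrt M * (1 - r)) *\<^sub>R ip x x"
        by (simp add: B_def ip_simps algebra_simps)
      finally show ?thesis by (simp add: cstar_le_def)
    qed
    show "B \<circ> B = S"
    proof
      fix x
      have "(B \<circ> B) x = M *\<^sub>R (x - Y x - (Y x - Y (Y x)))"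
        using M by (simp add: B_def blinfun.scaleR_right blinfun.diff_right flip: scaleR_diff_right)
      also have "\<dots> = M *\<^sub>R (x - T x)" by (simp add: YY scaleR_2)
      also have "\<dots> = S x" using M by (simp add: T_def)
      finally show "(B \<circ> B) x = S x" .
    qed
    fix V assume V: "bounded_linear V" "V \<circ> S = S \<circ> V"
    then interpret V: bounded_linear V by simp
    show "V \<circ> B = B \<circ> V" using K_comm[OF Y(1) V] by (auto simp: B_def V.scaleR V.diff)
  qed
qed

text \<open>The inverse of \<open>B\<close> is a positive root of \<open>inv S\<close>. To identify
  it with the definite description, any other positive root is shown to commute with
  \<open>B\<close> and then to agree with it.\<close>

lemma op_inv_sqrt_of_bounds:
  assumes adj: "is_adjoint ip S S" and C: "0 < C"
    and lower: "\<And>x. C *\<^sub>R ip x x \<le>\<^sub>A ip (S x) x" and upper: "\<And>x. ip (S x) x \<le>\<^sub>A D *\<^sub>R ip x x"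
  obtains B b where "is_adjoint ip B B" "0 < b" "\<And>x. b *\<^sub>R ip x x \<le>\<^sub>A ip (B x) x" "B \<circ> B = S"
    "\<And>V. bounded_linear V \<Longrightarrow> V \<circ> S = S \<circ> V \<Longrightarrow> V \<circ> B = B \<circ> V"
    "op_inv_sqrt ip S \<circ> B = id" "B \<circ> op_inv_sqrt ip S = id"
proof -
  obtain B b where B: "is_adjoint ip B B" "0 < b" "\<And>x. b *\<^sub>R ip x x \<le>\<^sub>A ip (B x) x" "B \<circ> B = S"
    and comm: "\<And>V. bounded_linear V \<Longrightarrow> V \<circ> S = S \<circ> V \<Longrightarrow> V \<circ> B = B \<circ> V"
    using exists_sqrt_of_bounds[OF assms] by metis
  have symB: "ip (B x) y = ip x (B y)" for x y using B(1) by (simp add: is_adjoint_def)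
  have posB: "cstar_positive (ip (B x) x)" for x
    using cstar_positive_add[of "ip (B x) x - b *\<^sub>R ip x x" "b *\<^sub>R ip x x"] B(2,3)
    by (simp add: cstar_le_def cstar_positive_scaleR ip_positive)
  have "bij S" by (rule bij_of_bounds[OF assms])
  then have "bij B"
    using B(4) by (metis bij_betw_def inj_on_imageI2 surj_fun_eq comp_surj bij_is_inj bij_is_surj
        fun.set_map surj_def comp_apply bijI)
  define R where "R = inv B"
  have BR: "B (R x) = x" and RB: "R (B x) = x" for x
    using \<open>bij B\<close> by (simp_all add: R_def bij_is_surj surj_f_inv_f bij_is_inj inv_f_f)
  have SB: "S x = B (B x)" for x using B(4) by (metis comp_apply)
  have invS: "inv S y = R (R y)" for y
    using \<open>bij S\<close> by (metis SB BR bij_inv_eq_iff)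
  have posR: "positive_op ip R"
    unfolding positive_op_def is_adjoint_def
  proof (intro conjI allI)
    show "ip (R x) y = ip x (R y)" for x y using symB[of "R x" "R y"] by (simp add: BR)
    show "cstar_positive (ip (R x) x)" for x
      using posB[of "R x"] symB[of "R x" "R x"] by (simp add: BR)
  qed
  have "R' = R" if R': "positive_op ip R' \<and> R' \<circ> R' = inv S" for R'
  proof
    fix x
    have adjR': "is_adjoint ip R' R'" and posR': "\<And>y. cstar_positive (ip (R' y) y)"
      and R'R': "\<And>y. R' (R' y) = R (R y)"
      using R' invS by (auto simp: positive_op_def fun_eq_iff)
    \<comment> \<open>This bound carries over to \<open>R'\<close>, whose square is that of
      \<open>R\<close>. It makes \<open>R'\<close> bounded, as \<open>comm\<close> demands.\<close>
    have inv_bound: "ip (R y) (R y) \<le>\<^sub>A (1 / b)\<^sup>2 *\<^sub>R ip y y" for y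
    proof -
      have "b *\<^sub>R ip (R y) (R y) \<le>\<^sub>A ip y (R y)" using B(3)[of "R y"] by (simp add: BR)
      then have "cstar_positive (2 *\<^sub>R (ip y (R y) - b *\<^sub>R ip (R y) (R y)))"
        by (intro cstar_positive_scaleR) (auto simp: cstar_le_def)
      moreover have "cstar_positive (b *\<^sub>R ip (R y) (R y) + (1 / b) *\<^sub>R ip y y - 2 *\<^sub>R ip y (R y))"
        using ip_young[OF B(2), of "R y" y] posR
        by (simp add: cstar_le_def scaleR_2 positive_op_def is_adjoint_def)
      ultimately have "cstar_positive ((1 / b) *\<^sub>R (2 *\<^sub>R (ip y (R y) - b *\<^sub>R ip (R y) (R y)) +
          (b *\<^sub>R ip (R y) (R y) + (1 / b) *\<^sub>R ip y y - 2 *\<^sub>R ip y (R y))))"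
        using B(2) by (intro cstar_positive_scaleR[OF cstar_positive_add]) auto
      also have "(1 / b) *\<^sub>R (2 *\<^sub>R (ip y (R y) - b *\<^sub>R ip (R y) (R y)) +
          (b *\<^sub>R ip (R y) (R y) + (1 / b) *\<^sub>R ip y y - 2 *\<^sub>R ip y (R y))) =
          (1 / b)\<^sup>2 *\<^sub>R ip y y - ip (R y) (R y)"
        using B(2) by (simp add: numeral_mult_eq_scaleR algebra_simps power2_eq_square)
      finally show ?thesis by (simp add: cstar_le_def)
    qed
    have "ip (R' y) (R' y) = ip (R y) (R y)" for y
      using adjR' posR R'R' by (metis is_adjoint_def positive_op_def)
    then have blR': "bounded_linear R'"
      using bounded_linear_of_adjoint[OF adjR', of "1 / b"] inv_bound B(2) by simp
    have "R' (S y) = S (R' y)" for y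
    proof -
      have "R' y = R' (R (R (S y)))" by (simp add: SB RB)
      also have "\<dots> = R (R (R' (S y)))" by (simp only: flip: R'R')
      finally show ?thesis by (simp add: SB BR)
    qed
    then have "R' \<circ> B = B \<circ> R'" by (intro comm blR') (auto simp: fun_eq_iff)
    then have "R' (B y) = B (R' y)" for y by (metis comp_apply)
    then have R'R: "R (R' y) = R' (R y)" for y by (metis BR RB)
    \<comment> \<open>Commuting roots of the same operator satisfy
      \<open>(R + R') (R - R') = 0\<close>. So the positive forms of \<open>R\<close> and
      \<open>R'\<close> at \<open>y\<close> add up to zero, and both vanish.\<close>
    define y where "y = R x - R' x"
    have adjR: "is_adjoint ip R R" using posR by (simp add: positive_op_def)
    have "R y + R' y = 0"
      by (simp add: y_def is_adjoint_diff[OF adjR] is_adjoint_diff[OF adjR'] R'R R'R')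
    then have "ip (R y) y + ip (R' y) y = 0" by (simp flip: ip_add_left)
    moreover have "cstar_positive (ip (R y) y)" using posR by (simp add: positive_op_def)
    moreover have "- ip (R y) y = ip (R' y) y" using calculation(1) by (rule minus_unique)
    ultimately have "ip (R y) y = 0" using posR'[of y] by (intro cstar_positive_antisym) auto
    then have "ip (B (R y)) (R y) = 0" using symB[of "R y" "R y"] by (simp add: BR)
    then have "cstar_positive (- (b *\<^sub>R ip (R y) (R y)))"
      using B(3)[of "R y"] by (simp add: cstar_le_def)
    then have "b *\<^sub>R ip (R y) (R y) = 0"
      using B(2) by (intro cstar_positive_antisym cstar_positive_scaleR ip_positive) auto
    then have "R y = 0" using B(2) by simp
    then have "B 0 = y" using BR by metis
    then have "y = 0" using is_adjoint_diff[OF B(1), of 0 0] by simp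
    then show "R' x = R x" by (simp add: y_def)
  qed
  then have "op_inv_sqrt ip S = R"
    unfolding op_inv_sqrt_def op_sqrt_def using posR invS by (intro the_equality) auto
  then show thesis using that[OF B comm] BR RB by (auto simp: fun_eq_iff)
qed

end

section \<open>Frame operators\<close>

text \<open>A Cauchy criterion: blocks of \<open>g\<close> disjoint from a large finite set are
  small, and they dominate the blocks of \<open>h\<close>. Absolute convergence of \<open>h\<close>
  is not at issue.\<close>

lemma summable_on_of_norm_partial_sums_le:
  fixes g :: "'i \<Rightarrow> 'b::banach" and h :: "'i \<Rightarrow> 'c::banach"
  assumes summable: "g summable_on J" and "0 < D"
    and le: "\<And>F. finite F \<Longrightarrow> F \<subseteq> J \<Longrightarrow> (norm (sum h F))\<^sup>2 \<le> D * norm (sum g F)"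
  shows "h summable_on J"
proof -
  have tail: "\<exists>F0. finite F0 \<and> F0 \<subseteq> J \<and> (\<forall>F. finite F \<and> F \<subseteq> J \<and> F \<inter> F0 = {} \<longrightarrow> norm (sum h F) < e)"
    if "e > 0" for e
  proof -
    \<comment> \<open>A block of \<open>g\<close> is a difference of two partial sums, so it is
      below \<open>2 * d\<close>, and \<open>D * (2 * d)\<close> is
      \<open>e\<^sup>2 / 2\<close>.\<close>
    define d where "d = e\<^sup>2 / (4 * D)"
    have "d > 0" using that \<open>0 < D\<close> by (simp add: d_def)
    have "(sum g \<longlongrightarrow> infsum g J) (finite_subsets_at_top J)"
      using summable by (simp add: has_sum_def[symmetric])
    then have "\<forall>\<^sub>F F in finite_subsets_at_top J. dist (sum g F) (infsum g J) < d"
      using \<open>d > 0\<close> by (rule tendstoD)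
    then obtain F0 where F0: "finite F0" "F0 \<subseteq> J"
      and close: "\<And>F. finite F \<Longrightarrow> F0 \<subseteq> F \<Longrightarrow> F \<subseteq> J \<Longrightarrow> dist (sum g F) (infsum g J) < d"
      unfolding eventually_finite_subsets_at_top by metis
    have "norm (sum h F) < e" if F: "finite F" "F \<subseteq> J" "F \<inter> F0 = {}" for F
    proof -
      have "sum g F = sum g (F0 \<union> F) - sum g F0"
        using F F0 by (simp add: sum.union_disjoint Int_commute)
      then have "norm (sum g F) \<le> dist (sum g (F0 \<union> F)) (infsum g J) + dist (sum g F0) (infsum g J)"
        by (metis dist_norm dist_triangle2)
      also have "\<dots> < d + d" using F F0 by (intro add_strict_mono close) auto
      finally have "D * norm (sum g F) < D * (d + d)" using \<open>0 < D\<close> by simp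
      also have "\<dots> \<le> e\<^sup>2" using \<open>0 < D\<close> by (simp add: d_def)
      finally have "(norm (sum h F))\<^sup>2 < e\<^sup>2" using le[OF F(1,2)] by linarith
      then show ?thesis using \<open>e > 0\<close> by (simp add: power2_less_imp_less)
    qed
    then show ?thesis using F0 by blast
  qed
  have "cauchy_filter (filtermap (sum h) (finite_subsets_at_top J))"
    unfolding cauchy_filter_metric_filtermap
  proof (intro allI impI)
    fix e :: real assume "e > 0"
    then obtain F0 where F0: "finite F0" "F0 \<subseteq> J"
      and small: "\<And>F. finite F \<Longrightarrow> F \<subseteq> J \<Longrightarrow> F \<inter> F0 = {} \<Longrightarrow> norm (sum h F) < e / 2"
      using tail[of "e / 2"] by (metis half_gt_zero)
    define P where "P = (\<lambda>F. finite F \<and> F0 \<subseteq> F \<and> F \<subseteq> J)"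
    have "dist (sum h F1) (sum h F2) < e" if "P F1" "P F2" for F1 F2
    proof -
      have "sum h F1 - sum h F2 = sum h (F1 - F0) - sum h (F2 - F0)"
        using that F0 by (simp add: P_def sum_diff)
      moreover have "norm (sum h (F1 - F0)) < e / 2" "norm (sum h (F2 - F0)) < e / 2"
        by (intro small; use that in \<open>auto simp: P_def\<close>)+
      ultimately show ?thesis
        using norm_triangle_ineq4[of "sum h (F1 - F0)" "sum h (F2 - F0)"] by (simp add: dist_norm)
    qed
    moreover have "\<forall>\<^sub>F F in finite_subsets_at_top J. P F"
      unfolding P_def eventually_finite_subsets_at_top using F0 by blast
    ultimately show "\<exists>P. (\<forall>\<^sub>F F in finite_subsets_at_top J. P F) \<and>
        (\<forall>x y. P x \<and> P y \<longrightarrow> dist (sum h x) (sum h y) < e)" by blast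
  qed
  moreover have "complete (UNIV :: 'c set)" by (rule complete_UNIV)
  ultimately obtain L where "(sum h \<longlongrightarrow> L) (finite_subsets_at_top J)"
    using complete_uniform[where S = "UNIV :: 'c set"] by (force simp add: filterlim_def)
  then show ?thesis using summable_on_def has_sum_def by blast
qed

context hilbert_module
begin

section \<open>Convergence and properties of the frame operator\<close>

lemma frame_term: "ip x y * ip y x = ip x y * star (ip x y)"
  by (metis ip_star)

lemma cstar_positive_frame_term: "cstar_positive (ip x y * ip y x)"
  unfolding frame_term by (rule cstar_positive_mult_star)

text \<open>For a finite partial sum \<open>z\<close>, Young's inequality with weight
  \<open>D\<close> bounds \<open>2 *\<^sub>R ip z z\<close> by the frame sums of \<open>x\<close>
  and \<open>z\<close>. The upper frame bound at \<open>z\<close> absorbs one copy of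
  \<open>ip z z\<close>.\<close>

lemma bessel_summable:
  assumes summable: "\<And>x. (\<lambda>j. ip x (f j) * ip (f j) x) summable_on J" and D: "0 < D"
    and bound: "\<And>x. (\<Sum>\<^sub>\<infinity>j\<in>J. ip x (f j) * ip (f j) x) \<le>\<^sub>A D *\<^sub>R ip x x"
  shows "(\<lambda>j. smul (ip x (f j)) (f j)) summable_on J"
proof (rule summable_on_of_norm_partial_sums_le[OF summable D])
  fix F assume F: "finite F" "F \<subseteq> J"
  define z where "z = (\<Sum>j\<in>F. smul (ip x (f j)) (f j))"
  define s where "s = (\<lambda>y. \<Sum>j\<in>F. ip y (f j) * ip (f j) y)"
  have zz: "ip z z = (\<Sum>j\<in>F. ip x (f j) * star (ip z (f j)))"
    by (subst z_def) (simp add: ip_sum_left ip_smul_left flip: ip_star)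
  then have "star (ip z z) = (\<Sum>j\<in>F. ip z (f j) * star (ip x (f j)))"
    by (simp add: star_sum star_mult star_star)
  then have "ip z z + ip z z =
      (\<Sum>j\<in>F. ip x (f j) * star (ip z (f j)) + ip z (f j) * star (ip x (f j)))"
    using zz ip_star[of z z] by (simp add: sum.distrib)
  also have "\<dots> \<le>\<^sub>A (\<Sum>j\<in>F. D *\<^sub>R (ip x (f j) * star (ip x (f j))) +
      (1 / D) *\<^sub>R (ip z (f j) * star (ip z (f j))))"
    by (intro cstar_le_sum_mono cstar_young D)
  also have "\<dots> = D *\<^sub>R s x + (1 / D) *\<^sub>R s z"
    by (simp add: s_def frame_term sum.distrib scaleR_sum_right)
  also have "\<dots> \<le>\<^sub>A D *\<^sub>R s x + (1 / D) *\<^sub>R (D *\<^sub>R ip z z)"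
  proof -
    have "s z \<le>\<^sub>A D *\<^sub>R ip z z"
      unfolding s_def
      using sum_cstar_le_infsum[OF summable cstar_positive_frame_term F] bound cstar_le_trans by blast
    then show ?thesis using D by (intro cstar_le_add_mono cstar_le_scaleR_mono) auto
  qed
  finally have "ip z z \<le>\<^sub>A D *\<^sub>R s x" using D by (simp add: cstar_le_def algebra_simps)
  then have "norm (ip z z) \<le> norm (D *\<^sub>R s x)" by (rule cstar_le_norm_mono[OF ip_positive])
  then show "(norm (\<Sum>j\<in>F. smul (ip x (f j)) (f j)))\<^sup>2 \<le> D * norm (\<Sum>j\<in>F. ip x (f j) * ip (f j) x)"
    using D by (simp add: norm_ip_self z_def s_def)
qed

lemma frame_operator_has_sum:
  assumes frame: "frame_bounds ip (G \<times> {1..N}) (\<lambda>(U, j). U (\<phi> j)) C D" and D: "0 < D"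
    and j: "j \<in> {1..N}"
  shows "((\<lambda>U. ip x (U (\<phi> j)) * ip (U (\<phi> j)) y) has_sum
      ip (\<Sum>\<^sub>\<infinity>U\<in>G. smul (ip x (U (\<phi> j))) (U (\<phi> j))) y) G"
proof -
  define h where "h = (\<lambda>p. smul (ip x ((\<lambda>(U, j). U (\<phi> j)) p)) ((\<lambda>(U, j). U (\<phi> j)) p))"
  have "h summable_on G \<times> {1..N}"
    using frame unfolding frame_bounds_def h_def by (intro bessel_summable[OF _ D]) auto
  then have "h summable_on G \<times> {j}"
    by (rule summable_on_subset_banach) (use j in auto)
  moreover have "bij_betw (\<lambda>U. (U, j)) G (G \<times> {j})" by (auto simp: bij_betw_def inj_on_def)
  ultimately have "(\<lambda>U. h (U, j)) summable_on G" 
    using summable_on_reindex_bij_betw[of "\<lambda>U. (U, j)" G "G \<times> {j}" h] by blast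
  then have "(\<lambda>U. smul (ip x (U (\<phi> j))) (U (\<phi> j))) summable_on G" by (simp add: h_def)
  then have "((\<lambda>U. smul (ip x (U (\<phi> j))) (U (\<phi> j))) has_sum
      (\<Sum>\<^sub>\<infinity>U\<in>G. smul (ip x (U (\<phi> j))) (U (\<phi> j)))) G" by simp
  from has_sum_bounded_linear[OF bounded_bilinear.bounded_linear_left[OF bounded_bilinear_ip, of y] this]
  show ?thesis by (simp add: ip_smul_left)
qed

lemma ip_frame_operator:
  assumes "frame_bounds ip (G \<times> {1..N}) (\<lambda>(U, j). U (\<phi> j)) C D" and "0 < D"
  shows "ip (frame_operator smul ip G N \<phi> x) y =
    (\<Sum>j=1..N. \<Sum>\<^sub>\<infinity>U\<in>G. ip x (U (\<phi> j)) * ip (U (\<phi> j)) y)"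
  unfolding frame_operator_def ip_sum_left
  by (intro sum.cong refl infsumI[OF frame_operator_has_sum, symmetric]) (use assms in auto)

lemma frame_operator_self_adjoint:
  assumes "frame_bounds ip (G \<times> {1..N}) (\<lambda>(U, j). U (\<phi> j)) C D" and "0 < D"
  shows "is_adjoint ip (frame_operator smul ip G N \<phi>) (frame_operator smul ip G N \<phi>)"
  unfolding is_adjoint_def
proof (intro allI)
  fix x y
  have "ip x (frame_operator smul ip G N \<phi> y) = star (ip (frame_operator smul ip G N \<phi> y) x)"
    by (rule ip_star)
  also have "\<dots> = (\<Sum>j=1..N. star (\<Sum>\<^sub>\<infinity>U\<in>G. ip y (U (\<phi> j)) * ip (U (\<phi> j)) x))"
    by (simp add: ip_frame_operator[OF assms] star_sum)
  also have "\<dots> = (\<Sum>j=1..N. \<Sum>\<^sub>\<infinity>U\<in>G. ip x (U (\<phi> j)) * ip (U (\<phi> j)) y)"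
  proof (rule sum.cong[OF refl])
    fix j assume j: "j \<in> {1..N}"
    have "((\<lambda>U. star (ip y (U (\<phi> j)) * ip (U (\<phi> j)) x)) has_sum
        star (\<Sum>\<^sub>\<infinity>U\<in>G. ip y (U (\<phi> j)) * ip (U (\<phi> j)) x)) G"
      using has_sum_bounded_linear[OF bounded_linear_star]
        frame_operator_has_sum[OF assms j] has_sum_infsum summable_on_def by blast
    moreover have "star (ip y z * ip z x) = ip x z * ip z y" for z
      by (metis ip_star star_mult)
    ultimately show "star (\<Sum>\<^sub>\<infinity>U\<in>G. ip y (U (\<phi> j)) * ip (U (\<phi> j)) x) =
        (\<Sum>\<^sub>\<infinity>U\<in>G. ip x (U (\<phi> j)) * ip (U (\<phi> j)) y)"
      by (simp add: infsumI)
  qed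
  finally show "ip (frame_operator smul ip G N \<phi> x) y = ip x (frame_operator smul ip G N \<phi> y)"
    by (simp add: ip_frame_operator[OF assms])
qed

text \<open>The frame condition sums over pairs, the frame operator sums over the group inside each
  generator; Fubini for the summable family reconciles them.\<close>

lemma infsum_frame_eq_ip_frame_operator:
  assumes frame: "frame_bounds ip (G \<times> {1..N}) (\<lambda>(U, j). U (\<phi> j)) C D" and "0 < D"
  shows "(\<Sum>\<^sub>\<infinity>p\<in>G \<times> {1..N}. ip x ((\<lambda>(U, j). U (\<phi> j)) p) * ip ((\<lambda>(U, j). U (\<phi> j)) p) x) =
    ip (frame_operator smul ip G N \<phi> x) x"
proof -
  have eq: "(\<lambda>p. ip x ((\<lambda>(U, j). U (\<phi> j)) p) * ip ((\<lambda>(U, j). U (\<phi> j)) p) x) =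
      (\<lambda>(U, j). ip x (U (\<phi> j)) * ip (U (\<phi> j)) x)" by auto
  have summable: "(\<lambda>(U, j). ip x (U (\<phi> j)) * ip (U (\<phi> j)) x) summable_on (G \<times> {1..N})"
    using frame unfolding frame_bounds_def eq[symmetric] by blast
  have "ip (frame_operator smul ip G N \<phi> x) x =
      (\<Sum>\<^sub>\<infinity>j\<in>{1..N}. \<Sum>\<^sub>\<infinity>U\<in>G. ip x (U (\<phi> j)) * ip (U (\<phi> j)) x)"
    by (simp add: ip_frame_operator[OF assms])
  also have "\<dots> = (\<Sum>\<^sub>\<infinity>U\<in>G. \<Sum>\<^sub>\<infinity>j\<in>{1..N}. ip x (U (\<phi> j)) * ip (U (\<phi> j)) x)"
    using infsum_swap_banach[OF summable] by simp
  also have "\<dots> = (\<Sum>\<^sub>\<infinity>(U, j)\<in>G \<times> {1..N}. ip x (U (\<phi> j)) * ip (U (\<phi> j)) x)"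
    by (rule infsum_Sigma'_banach[OF summable])
  finally show ?thesis unfolding eq by simp
qed

lemma frame_operator_bounds:
  assumes "frame_bounds ip (G \<times> {1..N}) (\<lambda>(U, j). U (\<phi> j)) C D" and "0 < D"
  shows "C *\<^sub>R ip x x \<le>\<^sub>A ip (frame_operator smul ip G N \<phi> x) x"
    and "ip (frame_operator smul ip G N \<phi> x) x \<le>\<^sub>A D *\<^sub>R ip x x"
  using assms(1) unfolding frame_bounds_def infsum_frame_eq_ip_frame_operator[OF assms] by blast+

text \<open>Polarisation: \<open>T = S - 1\<close> is self-adjoint with vanishing quadratic form,
  and evaluating the form at \<open>x + T x\<close> leaves
  \<open>2 *\<^sub>R ip (T x) (T x)\<close>.\<close>

lemma frame_operator_parseval:
  assumes "parseval_multi_frame_generator ip G N \<psi>"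
  shows "frame_operator smul ip G N \<psi> x = x"
proof -
  let ?S = "frame_operator smul ip G N \<psi>"
  have frame: "frame_bounds ip (G \<times> {1..N}) (\<lambda>(U, j). U (\<psi> j)) 1 1" "0 < (1 :: real)"
    using assms by (auto simp: parseval_multi_frame_generator_def is_parseval_frame_def)
  note adj = frame_operator_self_adjoint[OF frame]
  have eq: "ip (?S x) x = ip x x" for x
    using frame_operator_bounds[OF frame, of x] by (intro cstar_le_antisym) auto
  define T where "T = (\<lambda>x. ?S x - x)"
  have T0: "ip (T x) x = 0" for x by (simp add: T_def ip_diff_left eq)
  have T_add: "T (x + y) = T x + T y" for x y by (simp add: T_def is_adjoint_add[OF adj])
  have T_sym: "ip (T x) y = ip x (T y)" for x y
    using adj by (simp add: T_def ip_diff_left ip_diff_right is_adjoint_def)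
  have "0 = ip (T (x + T x)) (x + T x)" by (simp add: T0)
  also have "\<dots> = ip (T x) (T x) + ip (T (T x)) x" by (simp only: T_add ip_add_left ip_add_right T0) simp
  also have "\<dots> = 2 *\<^sub>R ip (T x) (T x)" by (simp add: T_sym[of "T x" x] scaleR_2)
  finally have "T x = 0" by simp
  then show ?thesis by (simp add: T_def)
qed

section \<open>Interaction with the unitary group\<close>

lemma unitary_group_adjoint:
  assumes "unitary_group ip G" "U \<in> G"
  shows "ip (U x) y = ip x (inv U y)" and "bij U" and "bounded_linear U"
proof -
  obtain U' where adj: "is_adjoint ip U U'" and inv: "U' \<circ> U = id" "U \<circ> U' = id"
    using assms by (auto simp: unitary_group_def unitary_op_def)
  show "bij U" using inv by (rule o_bij)
  have "inv U = U'" using inv by (rule inv_unique_comp[rotated])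
  then show "ip (U x) y = ip x (inv U y)" using adj by (simp add: is_adjoint_def)
  have "ip (U x) (U x) = ip x x" for x
    using adj inv(1) by (metis is_adjoint_def comp_apply id_apply)
  then show "bounded_linear U" using bounded_linear_of_adjoint[OF adj, of 1] by simp
qed

text \<open>Left translation by \<open>U\<close> permutes \<open>G\<close>, so the sum can be
  reindexed and \<open>U\<close> moved across the inner products.\<close>

lemma frame_operator_commute:
  assumes frame: "frame_bounds ip (G \<times> {1..N}) (\<lambda>(U, j). U (\<phi> j)) C D" "0 < D"
    and G: "unitary_group ip G" and U: "U \<in> G"
  shows "U \<circ> frame_operator smul ip G N \<phi> = frame_operator smul ip G N \<phi> \<circ> U"
proof (rule ext, rule ip_eqI)
  fix x y
  note U_adj = unitary_group_adjoint(1)[OF G U]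
  have U_inv: "inv U (U z) = z" "U (inv U z) = z" for z
    using unitary_group_adjoint(2)[OF G U] by (simp_all add: bij_is_inj bij_is_surj surj_f_inv_f)
  have closed: "V \<circ> W \<in> G" if "V \<in> G" "W \<in> G" for V W
    using G that by (auto simp: unitary_group_def)
  have invG: "inv U \<in> G" using G U by (auto simp: unitary_group_def)
  have bij: "bij_betw (\<lambda>V. U \<circ> V) G G"
    by (rule bij_betw_byWitness[where f' = "\<lambda>V. inv U \<circ> V"])
       (use closed U invG in \<open>auto simp: fun_eq_iff U_inv\<close>)
  have "ip (frame_operator smul ip G N \<phi> (U x)) y =
      (\<Sum>j=1..N. \<Sum>\<^sub>\<infinity>V\<in>G. ip (U x) ((U \<circ> V) (\<phi> j)) * ip ((U \<circ> V) (\<phi> j)) y)"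
    unfolding ip_frame_operator[OF frame]
    by (intro sum.cong refl infsum_reindex_bij_betw[OF bij, symmetric])
  also have "\<dots> = (\<Sum>j=1..N. \<Sum>\<^sub>\<infinity>V\<in>G. ip x (V (\<phi> j)) * ip (V (\<phi> j)) (inv U y))"
    by (simp add: U_adj U_inv)
  also have "\<dots> = ip (U (frame_operator smul ip G N \<phi> x)) y"
    by (simp add: U_adj ip_frame_operator[OF frame])
  finally show "ip ((U \<circ> frame_operator smul ip G N \<phi>) x) y =
      ip ((frame_operator smul ip G N \<phi> \<circ> U) x) y" by simp
qed

text \<open>Expand \<open>\<xi> k\<close> in the Parseval frame of \<open>\<psi>\<close>, move the unitaries to the other side, and resum in
  the Parseval frame of \<open>\<xi>\<close>. This is where commutativity of the algebra enters.\<close>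

lemma parseval_trace_eq:
  assumes G: "unitary_group ip G"
    and \<xi>: "parseval_multi_frame_generator ip G N \<xi>" and \<psi>: "parseval_multi_frame_generator ip G N \<psi>"
    and A: "is_adjoint ip A A" and comm: "\<And>U. U \<in> G \<Longrightarrow> U \<circ> A = A \<circ> U"
  shows "(\<Sum>k=1..N. ip (A (\<xi> k)) (\<xi> k)) = (\<Sum>k=1..N. ip (A (\<psi> k)) (\<psi> k))"
proof -
  have frame: "frame_bounds ip (G \<times> {1..N}) (\<lambda>(U, j). U (\<psi> j)) 1 1"
      "frame_bounds ip (G \<times> {1..N}) (\<lambda>(U, j). U (\<xi> j)) 1 1" "0 < (1 :: real)"
    using \<xi> \<psi> by (auto simp: parseval_multi_frame_generator_def is_parseval_frame_def)
  have expand_\<psi>: "ip x y = (\<Sum>j=1..N. \<Sum>\<^sub>\<infinity>U\<in>G. ip x (U (\<psi> j)) * ip (U (\<psi> j)) y)" for x y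
    using ip_frame_operator[OF frame(1,3), of x y] unfolding frame_operator_parseval[OF \<psi>] .
  have expand_\<xi>: "ip x y = (\<Sum>k=1..N. \<Sum>\<^sub>\<infinity>U\<in>G. ip x (U (\<xi> k)) * ip (U (\<xi> k)) y)" for x y
    using ip_frame_operator[OF frame(2,3), of x y] unfolding frame_operator_parseval[OF \<xi>] .
  have A_sym: "ip (A x) y = ip x (A y)" for x y using A by (simp add: is_adjoint_def)
  have invG: "inv U \<in> G" if "U \<in> G" for U using G that by (auto simp: unitary_group_def)
  have inv_inv: "inv (inv U) = U" if "U \<in> G" for U
    using unitary_group_adjoint(2)[OF G that] by (rule inv_inv_eq)
  have bij: "bij_betw inv G G"
    by (rule bij_betw_byWitness[where f' = inv]) (use invG inv_inv in auto)
  have term_eq: "ip (A x) (inv U y) * ip (inv U y) x = ip y (U x) * ip (U x) (A y)" if U: "U \<in> G" for U x y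
  proof -
    have "ip (A x) (inv U y) = ip (U (A x)) y" by (simp add: unitary_group_adjoint(1)[OF G U])
    also have "\<dots> = ip (U x) (A y)" using comm[OF U] by (metis A_sym comp_apply)
    finally have "ip (A x) (inv U y) = ip (U x) (A y)" .
    moreover have "ip (inv U y) x = ip y (U x)"
      using unitary_group_adjoint(1)[OF G invG[OF U]] by (simp add: inv_inv[OF U])
    ultimately show ?thesis by (simp add: mult.commute)
  qed
  have "(\<Sum>k=1..N. ip (A (\<xi> k)) (\<xi> k)) =
      (\<Sum>k=1..N. \<Sum>j=1..N. \<Sum>\<^sub>\<infinity>U\<in>G. ip (A (\<xi> k)) (U (\<psi> j)) * ip (U (\<psi> j)) (\<xi> k))"
    by (intro sum.cong refl expand_\<psi>)
  also have "\<dots> = (\<Sum>k=1..N. \<Sum>j=1..N. \<Sum>\<^sub>\<infinity>U\<in>G. ip (A (\<xi> k)) (inv U (\<psi> j)) * ip (inv U (\<psi> j)) (\<xi> k))"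
    by (intro sum.cong refl infsum_reindex_bij_betw[OF bij, symmetric])
  also have "\<dots> = (\<Sum>k=1..N. \<Sum>j=1..N. \<Sum>\<^sub>\<infinity>U\<in>G. ip (\<psi> j) (U (\<xi> k)) * ip (U (\<xi> k)) (A (\<psi> j)))"
    by (intro sum.cong refl infsum_cong term_eq)
  \<comment> \<open>Only the finite sums are exchanged; the single group sum stays innermost, so no
    double series over \<open>G\<close> arises.\<close>
  also have "\<dots> = (\<Sum>j=1..N. \<Sum>k=1..N. \<Sum>\<^sub>\<infinity>U\<in>G. ip (\<psi> j) (U (\<xi> k)) * ip (U (\<xi> k)) (A (\<psi> j)))"
    by (rule sum.swap)
  also have "\<dots> = (\<Sum>j=1..N. ip (\<psi> j) (A (\<psi> j)))"
    by (intro sum.cong refl expand_\<xi>[symmetric])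
  finally show ?thesis by (simp add: A_sym)
qed

end

theorem theorem4p3:
  fixes smul :: "'a::{unital_cstar_algebra, comm_ring_1} \<Rightarrow> 'h::banach \<Rightarrow> 'h"
    and ip :: "'h \<Rightarrow> 'h \<Rightarrow> 'a"
    and G :: "('h \<Rightarrow> 'h) set"
    and N :: nat
    and \<phi> :: "nat \<Rightarrow> 'h"
    and S :: "'h \<Rightarrow> 'h"
  assumes "hilbert_module smul ip"
    and "finitely_generated smul \<or> countably_generated smul"
    and "unitary_group ip G"
    and "multi_frame_generator ip G N \<phi>"
    and "S = frame_operator smul ip G N \<phi>"
  shows "best_parseval_approximation ip G N \<phi> (\<lambda>k. op_inv_sqrt ip S (\<phi> k)) \<and>
    (\<forall>\<psi>. best_parseval_approximation ip G N \<phi> \<psi> \<longrightarrow>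
       (\<forall>k\<in>{1..N}. \<psi> k = op_inv_sqrt ip S (\<phi> k)))"
proof -
  interpret hilbert_module smul ip by fact
  note G = assms(3)
  obtain C D where C: "0 < C" and D: "0 < D"
    and frame: "frame_bounds ip (G \<times> {1..N}) (\<lambda>(U, j). U (\<phi> j)) C D"
    using assms(4) by (auto simp: multi_frame_generator_def is_frame_def)
  have S_adj: "is_adjoint ip S S"
    unfolding assms(5) by (rule frame_operator_self_adjoint[OF frame D])
  have S_bounds: "\<And>x. C *\<^sub>R ip x x \<le>\<^sub>A ip (S x) x" "\<And>x. ip (S x) x \<le>\<^sub>A D *\<^sub>R ip x x"
    unfolding assms(5) by (rule frame_operator_bounds[OF frame D])+
  define R where "R = op_inv_sqrt ip S"
  obtain B b where B: "is_adjoint ip B B" and b: "0 < b" "\<And>x. b *\<^sub>R ip x x \<le>\<^sub>A ip (B x) x"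
    and BB: "B \<circ> B = S"
    and comm: "\<And>V. bounded_linear V \<Longrightarrow> V \<circ> S = S \<circ> V \<Longrightarrow> V \<circ> B = B \<circ> V"
    and R: "R \<circ> B = id" "B \<circ> R = id"
    unfolding R_def using op_inv_sqrt_of_bounds[OF S_adj C S_bounds] by metis
  have B_sym: "ip (B x) y = ip x (B y)" for x y using B by (simp add: is_adjoint_def)
  have RB: "R (B x) = x" and BR: "B (R x) = x" for x using R by (simp_all add: fun_eq_iff)
  have R_sym: "ip (R x) y = ip x (R y)" for x y using B_sym[of "R x" "R y"] by (simp add: BR)
  have UB: "U \<circ> B = B \<circ> U" if "U \<in> G" for U
    using comm[OF unitary_group_adjoint(3)[OF G that]] frame_operator_commute[OF frame D G that]
    by (simp add: assms(5))
  have UR: "U (R x) = R (U x)" if "U \<in> G" for U x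
    using UB[OF that] by (metis BR RB comp_apply)
  have B_nonneg: "cstar_positive (ip (B x) x)" for x
    using cstar_positive_add[of "ip (B x) x - b *\<^sub>R ip x x" "b *\<^sub>R ip x x"] b
    by (simp add: cstar_le_def cstar_positive_scaleR ip_positive)
  have B_definite: "x = 0" if "ip (B x) x = 0" for x
  proof -
    have "cstar_positive (- (b *\<^sub>R ip x x))" using b(2)[of x] that by (simp add: cstar_le_def)
    then have "b *\<^sub>R ip x x = 0"
      using b(1) by (intro cstar_positive_antisym cstar_positive_scaleR ip_positive) auto
    then show ?thesis using b(1) by simp
  qed
  define \<psi> where "\<psi> = (\<lambda>k. R (\<phi> k))"
  have \<phi>: "\<phi> k = B (\<psi> k)" for k by (simp add: \<psi>_def BR)
  have parseval: "parseval_multi_frame_generator ip G N \<psi>"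
    unfolding parseval_multi_frame_generator_def is_parseval_frame_def frame_bounds_def
  proof (intro conjI allI)
    show "countable (G \<times> {1..N})" using frame by (simp only: frame_bounds_def)
    fix x
    \<comment> \<open>Since \<open>R\<close> is self-adjoint and commutes with \<open>G\<close>, the
      coefficients of \<open>x\<close> against \<open>\<psi>\<close> are those of \<open>R x\<close>
      against \<open>\<phi>\<close>; the frame sum becomes the form of \<open>S\<close> at
      \<open>R x\<close>.\<close>
    have term_eq: "ip x ((\<lambda>(U, j). U (\<psi> j)) p) * ip ((\<lambda>(U, j). U (\<psi> j)) p) x =
        ip (R x) ((\<lambda>(U, j). U (\<phi> j)) p) * ip ((\<lambda>(U, j). U (\<phi> j)) p) (R x)"
      if "p \<in> G \<times> {1..N}" for p
      using that by (auto simp: \<psi>_def UR R_sym)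
    show "(\<lambda>p. ip x ((\<lambda>(U, j). U (\<psi> j)) p) * ip ((\<lambda>(U, j). U (\<psi> j)) p) x) summable_on G \<times> {1..N}"
      by (subst summable_on_cong[OF term_eq], assumption) (use frame in \<open>simp only: frame_bounds_def\<close>)
    have "(\<Sum>\<^sub>\<infinity>p\<in>G \<times> {1..N}. ip x ((\<lambda>(U, j). U (\<psi> j)) p) * ip ((\<lambda>(U, j). U (\<psi> j)) p) x) =
        ip (S (R x)) (R x)"
      by (subst infsum_cong[OF term_eq], assumption)
         (simp only: assms(5) infsum_frame_eq_ip_frame_operator[OF frame D])
    also have "\<dots> = ip x x" by (simp add: BR B_sym flip: BB)
    finally have sum: "(\<Sum>\<^sub>\<infinity>p\<in>G \<times> {1..N}. ip x ((\<lambda>(U, j). U (\<psi> j)) p) * ip ((\<lambda>(U, j). U (\<psi> j)) p) x) =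
        ip x x" .
    show "1 *\<^sub>R ip x x \<le>\<^sub>A
        (\<Sum>\<^sub>\<infinity>p\<in>G \<times> {1..N}. ip x ((\<lambda>(U, j). U (\<psi> j)) p) * ip ((\<lambda>(U, j). U (\<psi> j)) p) x)"
      and "(\<Sum>\<^sub>\<infinity>p\<in>G \<times> {1..N}. ip x ((\<lambda>(U, j). U (\<psi> j)) p) * ip ((\<lambda>(U, j). U (\<psi> j)) p) x) \<le>\<^sub>A
        1 *\<^sub>R ip x x"
      unfolding sum by simp_all
  qed
  define dist2 where "dist2 = (\<lambda>\<xi>. \<Sum>k=1..N. ip (\<phi> k - \<xi> k) (\<phi> k - \<xi> k))"
  have excess: "dist2 \<xi> - dist2 \<psi> = (\<Sum>k=1..N. ip (B (\<psi> k - \<xi> k)) (\<psi> k - \<xi> k))"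
    if \<xi>: "parseval_multi_frame_generator ip G N \<xi>" for \<xi>
  proof -
    \<comment> \<open>An identity for each single \<open>k\<close>. Its two correction terms need
      not vanish individually; they cancel only after summation over \<open>k\<close>, by the trace
      identity.\<close>
    have "ip (\<phi> k - \<xi> k) (\<phi> k - \<xi> k) - ip (\<phi> k - \<psi> k) (\<phi> k - \<psi> k) =
        ip (B (\<psi> k - \<xi> k)) (\<psi> k - \<xi> k) + (ip (\<xi> k) (\<xi> k) - ip (\<psi> k) (\<psi> k)) +
        (ip (B (\<psi> k)) (\<psi> k) - ip (B (\<xi> k)) (\<xi> k))" for k
      by (simp add: \<phi> ip_simps is_adjoint_diff[OF B] B_sym)
    then have "dist2 \<xi> - dist2 \<psi> = (\<Sum>k=1..N. ip (B (\<psi> k - \<xi> k)) (\<psi> k - \<xi> k)) +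
        ((\<Sum>k=1..N. ip (\<xi> k) (\<xi> k)) - (\<Sum>k=1..N. ip (\<psi> k) (\<psi> k))) +
        ((\<Sum>k=1..N. ip (B (\<psi> k)) (\<psi> k)) - (\<Sum>k=1..N. ip (B (\<xi> k)) (\<xi> k)))"
      by (simp add: dist2_def sum.distrib flip: sum_subtractf)
    moreover have "(\<Sum>k=1..N. ip (\<xi> k) (\<xi> k)) = (\<Sum>k=1..N. ip (\<psi> k) (\<psi> k))"
      using parseval_trace_eq[OF G \<xi> parseval, of id] by (simp add: is_adjoint_def)
    moreover have "(\<Sum>k=1..N. ip (B (\<xi> k)) (\<xi> k)) = (\<Sum>k=1..N. ip (B (\<psi> k)) (\<psi> k))"
      by (rule parseval_trace_eq[OF G \<xi> parseval B UB])
    ultimately show ?thesis by simp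
  qed
  have le: "dist2 \<psi> \<le>\<^sub>A dist2 \<xi>" if "parseval_multi_frame_generator ip G N \<xi>" for \<xi>
    unfolding cstar_le_def excess[OF that] by (intro cstar_positive_sum B_nonneg)
  then have "best_parseval_approximation ip G N \<phi> \<psi>"
    using parseval unfolding best_parseval_approximation_def dist2_def by blast
  moreover have "\<xi> k = \<psi> k"
    if \<xi>: "best_parseval_approximation ip G N \<phi> \<xi>" and k: "k \<in> {1..N}" for \<xi> k
  proof -
    have \<xi>_parseval: "parseval_multi_frame_generator ip G N \<xi>"
      using \<xi> by (simp add: best_parseval_approximation_def)
    have "dist2 \<xi> \<le>\<^sub>A dist2 \<psi>"
      using \<xi> parseval unfolding best_parseval_approximation_def dist2_def by blast
    then have "dist2 \<xi> = dist2 \<psi>" using le[OF \<xi>_parseval] by (rule cstar_le_antisym)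
    then have "(\<Sum>k=1..N. ip (B (\<psi> k - \<xi> k)) (\<psi> k - \<xi> k)) = 0"
      using excess[OF \<xi>_parseval] by simp
    from cstar_positive_sum_eq_0[OF _ B_nonneg this k] have "\<psi> k - \<xi> k = 0"
      by (intro B_definite) simp
    then show ?thesis by simp
  qed
  ultimately show ?thesis unfolding \<psi>_def R_def by blast
qed

end
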